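(* Let $n > 2$ and $k > 0$ be integers, and let $S^k$ denote the $k$-dimensional sphere. Then $\mathrm{TC}_n(S^k) = n$ if $k$ is odd, and $\mathrm{TC}_n(S^k) = n+1$ if $k$ is even.
   Context: A fibration is a map with the homotopy lifting property. The Schwarz genus of a fibration $p: E \to B$ is the minimum number $k$ such that there exists an open covering $U_1, \ldots, U_k$ of $B$ where each $U_i$ admits a continuous map $s_i: U_i \to E$ with $p s_i(b) = b$ for all $b \in U_i$ (the genus is $\infty$ if no such $k$ exists). Let $J_n$ denote the wedge of $n$ closed intervals $[0,1]_i$, $i=1,\ldots,n$, where the zero points $0_i \in [0,1]_i$ are identified; let $1_i \in [0,1]_i$ be the unit. For a path connected space $X$ set $T_n(X) := X^{J_n}$ (the space of continuous maps $J_n \to X$), and let $e_n: T_n(X) \to X^n$ be the fibration $e_n(f) = (f(1_1), \ldots, f(1_n))$. The higher topological complexity $\mathrm{TC}_n(X)$ is defined to be the Schwarz genus of $e_n$. *)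

theory Defs
  imports "HOL-Analysis.Analysis" "HOL-Library.Extended_Nat"
begin

definition quotient_topology :: "'a topology \<Rightarrow> ('a \<Rightarrow> 'b) \<Rightarrow> 'b topology" where
  "quotient_topology X q =
     topology (\<lambda>U. U \<subseteq> q ` topspace X \<and> openin X {x \<in> topspace X. q x \<in> U})"

lemma istopology_quotient_topology:
  "istopology (\<lambda>U. U \<subseteq> q ` topspace X \<and> openin X {x \<in> topspace X. q x \<in> U})"
proof -
  have 1: "{x \<in> topspace X. q x \<in> S \<inter> T} = {x \<in> topspace X. q x \<in> S} \<inter> {x \<in> topspace X. q x \<in> T}"
    for S T by auto
  have 2: "{x \<in> topspace X. q x \<in> \<Union>\<K>} = (\<Union>K\<in>\<K>. {x \<in> topspace X. q x \<in> K})" for \<K>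
    by auto
  show ?thesis
    unfolding istopology_def 1 2 by blast
qed

lemma openin_quotient_topology:
  "openin (quotient_topology X q) U \<longleftrightarrow>
     U \<subseteq> q ` topspace X \<and> openin X {x \<in> topspace X. q x \<in> U}"
  by (simp add: quotient_topology_def istopology_quotient_topology)

lemma topspace_quotient_topology [simp]: "topspace (quotient_topology X q) = q ` topspace X"
proof -
  have "{x \<in> topspace X. q x \<in> q ` topspace X} = topspace X"
    by auto
  then have "openin (quotient_topology X q) (q ` topspace X)"
    by (simp add: openin_quotient_topology)
  then show ?thesis
    by (metis openin_quotient_topology openin_subset openin_topspace subset_antisym)
qed

lemma quotient_map_quotient_topology: "quotient_map X (quotient_topology X q) q"
  by (simp add: quotient_map_def openin_quotient_topology)

text \<open>The point \<open>t\<close> of the \<open>i\<close>-th interval is represented by \<open>(i, t)\<close> for \<open>t \<noteq> 0\<close>; all the zero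
  points are represented by the extra point \<open>(0, 0)\<close>, the intervals being numbered from 1.\<close>

definition wedge_proj :: "nat \<times> real \<Rightarrow> nat \<times> real" where
  "wedge_proj z = (if snd z = 0 then (0, 0) else z)"

definition interval_wedge :: "nat \<Rightarrow> (nat \<times> real) topology" where
  "interval_wedge n =
     quotient_topology (sum_topology (\<lambda>i. top_of_set {0..1::real}) {1..n}) wedge_proj"

lemma wedge_proj_eq_iff:
  assumes "i \<ge> 1" "j \<ge> 1"
  shows "wedge_proj (i, s) = wedge_proj (j, t) \<longleftrightarrow> s = 0 \<and> t = 0 \<or> i = j \<and> s = t"
  using assms by (auto simp: wedge_proj_def)

text \<open>The space \<open>X\<^sup>J\<close> of continuous maps with the compact-open topology. Maps are made
  \<open>extensional\<close> so that two points of the space are equal iff they agree on \<open>J\<close>.\<close>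

definition cmaps :: "'a topology \<Rightarrow> 'b topology \<Rightarrow> ('a \<Rightarrow> 'b) set" where
  "cmaps J X = {f. continuous_map J X f \<and> f \<in> extensional (topspace J)}"

definition map_space :: "'a topology \<Rightarrow> 'b topology \<Rightarrow> ('a \<Rightarrow> 'b) topology" where
  "map_space J X =
     topology_generated_by {{f \<in> cmaps J X. f ` K \<subseteq> U} | K U. compactin J K \<and> openin X U}"

lemma topspace_map_space [simp]: "topspace (map_space J X) = cmaps J X"
proof -
  have "cmaps J X \<in> {{f \<in> cmaps J X. f ` K \<subseteq> U} | K U. compactin J K \<and> openin X U}"
    by (intro CollectI exI[of _ "{}"]) auto
  then show ?thesis
    unfolding map_space_def topology_generated_by_topspace by blast
qed

text \<open>The Schwarz genus of \<open>p: E \<rightarrow> B\<close>; note \<open>Inf {} = \<infinity>\<close> for \<open>enat\<close>.\<close>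

definition schwarz_genus :: "'e topology \<Rightarrow> 'b topology \<Rightarrow> ('e \<Rightarrow> 'b) \<Rightarrow> enat" where
  "schwarz_genus E B p =
     Inf {enat k | k. \<exists>U. (\<forall>i\<in>{1..k}. openin B (U i)) \<and> (\<Union>i\<in>{1..k}. U i) = topspace B \<and>
        (\<forall>i\<in>{1..k}. \<exists>s. continuous_map (subtopology B (U i)) E s \<and> (\<forall>b\<in>U i. p (s b) = b))}"

definition end_eval :: "nat \<Rightarrow> (nat \<times> real \<Rightarrow> 'a) \<Rightarrow> (nat \<Rightarrow> 'a)" where
  "end_eval n f = (\<lambda>i\<in>{1..n}. f (wedge_proj (i, 1)))"

definition TC :: "nat \<Rightarrow> 'a topology \<Rightarrow> enat" where
  "TC n X = schwarz_genus (map_space (interval_wedge n) X)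
              (product_topology (\<lambda>_. X) {1..n}) (end_eval n)"

lemma continuous_map_end_eval:
  "continuous_map (map_space (interval_wedge n) X) (product_topology (\<lambda>_. X) {1..n}) (end_eval n)"
proof -
  let ?J = "interval_wedge n"
  have J: "wedge_proj (i, 1) \<in> topspace ?J" if "i \<in> {1..n}" for i
    using that by (auto simp: interval_wedge_def intro!: imageI)
  have "continuous_map (map_space ?J X) X (\<lambda>f. f (wedge_proj (i, 1)))" if i: "i \<in> {1..n}" for i
    unfolding continuous_map
  proof (intro conjI allI impI)
    show "(\<lambda>f. f (wedge_proj (i, 1))) ` topspace (map_space ?J X) \<subseteq> topspace X"
      using J[OF i] by (auto simp: cmaps_def continuous_map_def)
    fix U assume U: "openin X U"
    have "{f \<in> cmaps ?J X. f ` {wedge_proj (i, 1)} \<subseteq> U} \<in>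
        {{f \<in> cmaps ?J X. f ` K \<subseteq> U} | K U. compactin ?J K \<and> openin X U}"
      using U J[OF i] by (intro CollectI exI[of _ "{wedge_proj (i, 1)}"] exI[of _ U]) auto
    then have "openin (map_space ?J X) {f \<in> cmaps ?J X. f ` {wedge_proj (i, 1)} \<subseteq> U}"
      unfolding map_space_def by (rule topology_generated_by_Basis)
    then show "openin (map_space ?J X) {f \<in> topspace (map_space ?J X). f (wedge_proj (i, 1)) \<in> U}"
      by simp
  qed
  then show ?thesis
    by (auto simp: continuous_map_componentwise end_eval_def)
qed

end

(*
  Lower bound. On the open sets of a cover with local sections all the coordinate projections
  (S^k)^n -> S^k become homotopic, so the classes phi_b - phi_1 (phi_b the pullback of the
  generator of H^k(S^k) along the b-th projection) become trivial there, and a product of as many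
  such classes as there are open sets vanishes. The product over b = 2, ..., n is not zero, and
  for even k neither is the product with the factor b = 2 repeated, its value being -2.
  This is done with Alexander-Spanier cochains (functions on tuples of nearby points), for which
  neither subdivision nor excision is needed: a cochain on a subset is extended by zero, and a
  tuple of small diameter lies inside one member of the cover. The generator has the explicit
  form dH_k u ... u dH_1 u H_0, where H_j is the indicator function of {x_j >= 0}; nonvanishing
  is detected by cycles that are built one factor at a time by iterated suspension.

  Upper bound. Move from x_1 to x_i along the shortest arc, or, when x_i is close to -x_1, along
  an arc that is bent in the direction of a vector v(x_1) independent of x_1. The set of indices i
  with x_i = -x_1 stratifies the product into n strata. For even k the vector v = e_0 fails at
  x_1 = e_0 and x_1 = -e_0, and x_1 lying at one of them counts as one more degeneracy, to be
  resolved with v = e_1.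
*)
theory Submission
  imports Defs
begin

section \<open>Cochains on lists of points\<close>

text \<open>Everything on the cohomology side rests on one size estimate. The coboundary of
  \<open>phi j\<close> is, up to sign, the product of the jumps of all of H_j, ..., H_0; where it is
  nonzero every sign changes within a tuple of nearby points, so all coordinates are small, which is
  impossible for a unit vector. This is the origin of the condition
  \<open>4 * (real k + 1) * e\<^sup>2 < 1\<close>. The difference classes die over a section because
  arm b deforms the image of the base point of the wedge into the b-th projection, and that image is
  the same for all b. The obstacle to building cycles by suspension is the end of the cone at its
  apex. The property \<open>kills_indep\<close> makes this end vanish and is inherited by the
  suspension; each suspension strips one factor dH and enlarges the tuples, so sizes have to be
  budgeted. The two mixed products in the square of a difference class have the values 1 and (-1)^k;
  they cancel for odd k and add up for even k. A vector v(x_1) that is nowhere parallel to x_1 would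
  give a tangent field without zeros; for even k none exists, hence the additional stratum.\<close>

text \<open>The empty list makes this the augmented coboundary; cochains are therefore required to vanish
  at \<open>[]\<close> wherever that matters.\<close>

fun cobd :: "('a list \<Rightarrow> int) \<Rightarrow> 'a list \<Rightarrow> int" where
  "cobd f [] = 0"
| "cobd f (x # xs) = f xs - cobd (\<lambda>ys. f (x # ys)) xs"

lemma cobd_linear: "cobd (\<lambda>ys. a * f ys + c * g ys) xs = a * cobd f xs + c * cobd g xs"
  by (induction xs arbitrary: f g) (auto simp: algebra_simps)

lemma cobd_add: "cobd (\<lambda>ys. f ys + g ys) xs = cobd f xs + cobd g xs"
  using cobd_linear[of 1 f 1 g] by simp

lemma cobd_diff: "cobd (\<lambda>ys. f ys - g ys) xs = cobd f xs - cobd g xs"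
  using cobd_linear[of 1 f "-1" g] by simp

lemma cobd_scale: "cobd (\<lambda>ys. a * f ys) xs = a * cobd f xs"
  using cobd_linear[of a f 0 f] by simp

lemma cobd_0: "cobd (\<lambda>ys. 0) xs = 0"
  using cobd_scale[of 0 "\<lambda>_. 0" xs] by simp

lemma cobd_sum: "cobd (\<lambda>ys. \<Sum>i\<in>I. f i ys) xs = (\<Sum>i\<in>I. cobd (f i) xs)"
  by (induction I rule: infinite_finite_induct) (auto simp: cobd_add cobd_0)

lemma cobd_cobd: "cobd (cobd f) xs = 0"
  by (induction xs arbitrary: f) (auto simp: cobd_diff)

lemma cobd_map: "cobd f (map h xs) = cobd (\<lambda>ys. f (map h ys)) xs"
  by (induction xs arbitrary: f) auto

lemma cobd_cong:
  assumes "\<And>ys. set ys \<subseteq> set xs \<Longrightarrow> Suc (length ys) = length xs \<Longrightarrow> f ys = g ys"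
  shows "cobd f xs = cobd g xs"
  using assms
proof (induction xs arbitrary: f g)
  case (Cons x xs)
  have "f xs = g xs" by (rule Cons.prems) auto
  moreover have "cobd (\<lambda>ys. f (x # ys)) xs = cobd (\<lambda>ys. g (x # ys)) xs"
    by (rule Cons.IH, rule Cons.prems) auto
  ultimately show ?case by simp
qed simp

section \<open>Cup products\<close>

definition cup :: "nat \<Rightarrow> ('a list \<Rightarrow> int) \<Rightarrow> ('a list \<Rightarrow> int) \<Rightarrow> 'a list \<Rightarrow> int" where
  "cup m f g xs = f (take (Suc m) xs) * g (drop m xs)"

text \<open>Leibniz rule. The face of the front part without its last point and the face of the back
  part without its first point give the same product with opposite signs, so these two surplus terms
  cancel.\<close>

lemma cobd_cup:
  assumes "length xs \<ge> m + 2"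
  shows "cobd (cup m f g) xs = cup (Suc m) (cobd f) g xs + (-1) ^ m * cup m f (cobd g) xs"
  using assms
proof (induction m arbitrary: xs f)
  case 0
  then obtain x y zs where xs: "xs = x # y # zs"
    by (metis Suc_le_length_iff add_2_eq_Suc' One_nat_def add_0)
  have "(\<lambda>ys. cup 0 f g (x # ys)) = (\<lambda>ys. f [x] * g (x # ys))"
    by (simp add: cup_def)
  then show ?case
    by (simp add: xs cobd_scale) (simp add: cup_def cobd_scale algebra_simps)
next
  case (Suc m)
  then obtain x ys where xs: "xs = x # ys" "length ys \<ge> m + 2"
    by (cases xs) auto
  have "(\<lambda>ys. cup (Suc m) f g (x # ys)) = cup m (\<lambda>ys. f (x # ys)) g"
    by (simp add: cup_def fun_eq_iff)
  then have "cobd (cup (Suc m) f g) xs = cup (Suc m) f g ys - cobd (cup m (\<lambda>ys. f (x # ys)) g) ys"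
    by (simp add: xs)
  also have "\<dots> = cup (Suc m) f g ys - (cup (Suc m) (cobd (\<lambda>ys. f (x # ys))) g ys
      + (-1) ^ m * cup m (\<lambda>ys. f (x # ys)) (cobd g) ys)"
    by (subst Suc.IH) (use xs in auto)
  also have "\<dots> = cup (Suc (Suc m)) (cobd f) g xs + (-1) ^ Suc m * cup (Suc m) f (cobd g) xs"
    by (simp add: xs cup_def algebra_simps)
  finally show ?case .
qed

section \<open>Prism operators of discrete homotopies\<close>

fun prism :: "('a \<Rightarrow> 'b) \<Rightarrow> ('a \<Rightarrow> 'b) \<Rightarrow> ('b list \<Rightarrow> int) \<Rightarrow> 'a list \<Rightarrow> int" where
  "prism h h' f [] = 0"
| "prism h h' f (x # xs) = f (h x # map h' (x # xs)) - prism h h' (\<lambda>ys. f (h x # ys)) xs"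

lemma prism_linear:
  "prism h h' (\<lambda>ys. a * f ys + c * g ys) xs = a * prism h h' f xs + c * prism h h' g xs"
  by (induction xs arbitrary: f g) (auto simp: algebra_simps)

lemma prism_diff: "prism h h' (\<lambda>ys. f ys - g ys) xs = prism h h' f xs - prism h h' g xs"
  using prism_linear[of h h' 1 f "-1" g] by simp

lemma prism_cong:
  assumes "\<And>ys. set ys \<subseteq> h ` set xs \<union> h' ` set xs \<Longrightarrow> length ys = Suc (length xs) \<Longrightarrow> f ys = g ys"
  shows "prism h h' f xs = prism h h' g xs"
  using assms
proof (induction xs arbitrary: f g)
  case (Cons x xs)
  have "f (h x # map h' (x # xs)) = g (h x # map h' (x # xs))" by (rule Cons.prems) auto
  moreover have "prism h h' (\<lambda>ys. f (h x # ys)) xs = prism h h' (\<lambda>ys. g (h x # ys)) xs"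
    by (rule Cons.IH, rule Cons.prems) auto
  ultimately show ?case by simp
qed simp

text \<open>The prism over x_0, ..., x_p is the alternating sum over i of the tuples (h x_0, ..., h
  x_i, h' x_i, ..., h' x_p). The formula is purely combinatorial and holds for arbitrary maps;
  nearness of \<open>h\<close> and \<open>h'\<close> matters only when the prism tuples have to be
  small.\<close>

lemma prism_homotopy:
  "prism h h' (cobd f) xs + cobd (prism h h' f) xs = f (map h' xs) - f (map h xs)"
proof (induction xs arbitrary: f)
  case (Cons x xs)
  show ?case
    using Cons.IH[of "\<lambda>ys. f (h x # ys)"]
    by (simp add: prism_diff cobd_diff cobd_map algebra_simps)
qed simp

text \<open>A homotopy sampled at the times 0, ..., N, with one prism per step, so that the stages
  joined by a prism can be made as near as needed.\<close>

definition hprism :: "(nat \<Rightarrow> 'a \<Rightarrow> 'b) \<Rightarrow> nat \<Rightarrow> ('b list \<Rightarrow> int) \<Rightarrow> 'a list \<Rightarrow> int" where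
  "hprism h N f xs = (\<Sum>i<N. prism (h i) (h (Suc i)) f xs)"

lemma hprism_Nil [simp]: "hprism h N f [] = 0"
  by (simp add: hprism_def)

lemma hprism_linear:
  "hprism h N (\<lambda>ys. a * f ys + c * g ys) xs = a * hprism h N f xs + c * hprism h N g xs"
  by (simp add: hprism_def prism_linear sum.distrib sum_distrib_left)

lemma hprism_cong:
  assumes "\<And>i ys. i < N \<Longrightarrow> set ys \<subseteq> h i ` set xs \<union> h (Suc i) ` set xs \<Longrightarrow>
             length ys = Suc (length xs) \<Longrightarrow> f ys = g ys"
  shows "hprism h N f xs = hprism h N g xs"
  unfolding hprism_def by (intro sum.cong refl prism_cong assms) auto

lemma hprism_homotopy:
  "hprism h N (cobd f) xs + cobd (hprism h N f) xs = f (map (h N) xs) - f (map (h 0) xs)"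
proof -
  have "hprism h N (cobd f) xs + cobd (hprism h N f) xs =
      (\<Sum>i<N. f (map (h (Suc i)) xs) - f (map (h i) xs))"
    unfolding hprism_def cobd_sum sum.distrib[symmetric] prism_homotopy ..
  then show ?thesis
    by (simp add: sum_lessThan_telescope[where f = "\<lambda>i. f (map (h i) xs)"])
qed

section \<open>The fundamental cocycle of the sphere\<close>

definition pos :: "nat \<Rightarrow> (nat \<Rightarrow> real) \<Rightarrow> int" where
  "pos j v = (if v j \<ge> 0 then 1 else 0)"

text \<open>The cocycle \<open>dH\<^sub>j \<union> \<dots> \<union> dH\<^sub>1 \<union> H\<^sub>0\<close> with \<open>H\<^sub>i = pos i\<close>.\<close>

fun phi :: "nat \<Rightarrow> (nat \<Rightarrow> real) list \<Rightarrow> int" where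
  "phi 0 [v] = pos 0 v"
| "phi (Suc j) (u # v # vs) = (pos (Suc j) v - pos (Suc j) u) * phi j (v # vs)"
| "phi _ _ = 0"

lemma phi_Nil [simp]: "phi j [] = 0" by (cases j) auto

lemma cobd_mult_hd:
  "cobd (\<lambda>xs. c (hd xs) * f xs) (x # y # zs) = (c y - c x) * f (y # zs) + c x * cobd f (x # y # zs)"
  by (simp add: cobd_scale algebra_simps)

text \<open>\<open>H\<^sub>j\<^sub>+\<^sub>1 \<union> phi j\<close>, a primitive of \<open>phi (Suc j)\<close> on small tuples of the lower hemisphere.\<close>

definition preprim :: "nat \<Rightarrow> (nat \<Rightarrow> real) list \<Rightarrow> int" where
  "preprim j vs = pos (Suc j) (hd vs) * phi j vs"

lemma cobd_preprim:
  "cobd (preprim j) (u # v # vs) = phi (Suc j) (u # v # vs) + pos (Suc j) u * cobd (phi j) (u # v # vs)"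
  unfolding preprim_def[abs_def] cobd_mult_hd by simp

text \<open>By \<open>cobd_preprim\<close>, \<open>phi (Suc j)\<close> is a coboundary minus the
  product of H_(j+1) with \<open>cobd (phi j)\<close>. Taking the coboundary once more kills the
  first term and replaces H_(j+1) by its jump in the second.\<close>

lemma cobd_phi_Suc:
  "cobd (phi (Suc j)) (u # v # w # vs) = - (pos (Suc j) v - pos (Suc j) u) * cobd (phi j) (v # w # vs)"
proof -
  have eq: "phi (Suc j) ys = cobd (preprim j) ys - pos (Suc j) (hd ys) * cobd (phi j) ys"
    if "length ys \<ge> 2" for ys
    using that cobd_preprim[of j "hd ys" "hd (tl ys)" "tl (tl ys)"]
    by (cases ys; cases "tl ys") auto
  have "cobd (phi (Suc j)) (u # v # w # vs) =
     cobd (\<lambda>ys. cobd (preprim j) ys - pos (Suc j) (hd ys) * cobd (phi j) ys) (u # v # w # vs)"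
    by (rule cobd_cong, rule eq) auto
  also have "\<dots> = - cobd (\<lambda>ys. pos (Suc j) (hd ys) * cobd (phi j) ys) (u # v # w # vs)"
    by (simp only: cobd_diff cobd_cobd)
  also have "\<dots> = - (pos (Suc j) v - pos (Suc j) u) * cobd (phi j) (v # w # vs)"
    by (simp only: cobd_mult_hd cobd_cobd)
  finally show ?thesis .
qed

text \<open>Iterating \<open>cobd_phi_Suc\<close> exhibits the coboundary as plus or minus a product
  of jumps of H_j, ..., H_0 between consecutive points, and every factor has to be nonzero.\<close>

lemma cobd_phi_nonzero:
  assumes "length vs = j + 2" "cobd (phi j) vs \<noteq> 0" "i \<le> j"
  shows "\<exists>u\<in>set vs. \<exists>v\<in>set vs. pos i u \<noteq> pos i v"
  using assms
proof (induction j arbitrary: vs)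
  case 0
  then obtain u v where "vs = [u, v]"
    by (auto simp: numeral_2_eq_2 length_Suc_conv)
  with 0 show ?case by auto
next
  case (Suc j)
  have "length vs = Suc (Suc (Suc j))" using Suc.prems(1) by simp
  then obtain u v w ws where vs: "vs = u # v # w # ws" and len: "length ws = j"
    unfolding length_Suc_conv by blast
  have nz: "pos (Suc j) v \<noteq> pos (Suc j) u" "cobd (phi j) (v # w # ws) \<noteq> 0"
    using Suc.prems(2) unfolding vs cobd_phi_Suc by (simp_all del: cobd.simps)
  show ?case
  proof (cases "i = Suc j")
    case True
    have "u \<in> set vs" "v \<in> set vs" unfolding vs by simp_all
    with nz(1) True show ?thesis by blast
  next
    case False
    with Suc.prems(3) have "i \<le> j" by simp
    moreover have "length (v # w # ws) = j + 2" using len by simp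
    ultimately have "\<exists>u\<in>set (v # w # ws). \<exists>v\<in>set (v # w # ws). pos i u \<noteq> pos i v"
      using Suc.IH nz(2) by blast
    moreover have "set (v # w # ws) \<subseteq> set vs" unfolding vs by auto
    ultimately show ?thesis by blast
  qed
qed

definition Sph :: "nat \<Rightarrow> (nat \<Rightarrow> real) set" where
  "Sph k = {v. (\<Sum>i\<le>k. (v i)\<^sup>2) = 1 \<and> (\<forall>i>k. v i = 0)}"

definition close :: "real \<Rightarrow> (nat \<Rightarrow> real) \<Rightarrow> (nat \<Rightarrow> real) \<Rightarrow> bool" where
  "close e u v \<longleftrightarrow> (\<forall>i. \<bar>u i - v i\<bar> \<le> e)"

text \<open>The sign change puts \<open>u i\<close> within \<open>e\<close> of zero, and
  \<open>w i\<close> is within \<open>e\<close> of \<open>u i\<close>.\<close>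

lemma pos_neq_close:
  assumes "pos i u \<noteq> pos i v" "close e u v" "close e u w"
  shows "\<bar>w i\<bar> \<le> 2 * e"
proof -
  have "\<bar>u i - v i\<bar> \<le> e" "\<bar>u i - w i\<bar> \<le> e"
    using assms(2,3) unfolding close_def by blast+
  moreover have "u i \<ge> 0 \<and> v i < 0 \<or> u i < 0 \<and> v i \<ge> 0"
    using assms(1) unfolding pos_def by argo
  ultimately show ?thesis
    unfolding abs_le_iff by argo
qed

lemma not_all_small:
  assumes "w \<in> Sph k" "\<And>i. i \<le> k \<Longrightarrow> \<bar>w i\<bar> \<le> 2 * e" "4 * (real k + 1) * e\<^sup>2 < 1"
  shows False
proof -
  have "(\<Sum>i\<le>k. (w i)\<^sup>2) \<le> (\<Sum>i\<le>k. (2 * e)\<^sup>2)"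
  proof (intro sum_mono)
    fix i assume "i \<in> {..k}"
    then have "\<bar>w i\<bar> \<le> 2 * e" using assms(2)[of i] by simp
    then have "\<bar>w i\<bar> \<le> \<bar>2 * e\<bar>" by linarith
    then show "(w i)\<^sup>2 \<le> (2 * e)\<^sup>2" by (simp only: abs_le_square_iff)
  qed
  also have "\<dots> = (real k + 1) * (2 * e)\<^sup>2" by simp
  also have "\<dots> = 4 * (real k + 1) * e\<^sup>2" by (simp only: power_mult_distrib) simp
  also have "\<dots> < 1" by (rule assms(3))
  finally show False using assms(1) unfolding Sph_def by simp
qed

lemma phi_cocycle:
  assumes "length vs = j + 2" "set vs \<subseteq> Sph j" "\<And>u v. u \<in> set vs \<Longrightarrow> v \<in> set vs \<Longrightarrow> close e u v"
    and "4 * (real j + 1) * e\<^sup>2 < 1"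
  shows "cobd (phi j) vs = 0"
proof (rule ccontr)
  assume nz: "cobd (phi j) vs \<noteq> 0"
  obtain w where w: "w \<in> set vs" using assms(1) by (cases vs) auto
  have "\<bar>w i\<bar> \<le> 2 * e" if ij: "i \<le> j" for i
  proof -
    obtain u v where "u \<in> set vs" "v \<in> set vs" "pos i u \<noteq> pos i v"
      using cobd_phi_nonzero[OF assms(1) nz ij] by blast
    then show ?thesis
      using pos_neq_close assms(3) w by blast
  qed
  then show False using not_all_small[of w j e] assms w by auto
qed

text \<open>The error term in \<open>cobd_preprim\<close> is H_(j+1) at the first point times
  \<open>cobd (phi j)\<close>. In the lower hemisphere the first factor is nonzero only on the
  equator, where coordinate j + 1 is 0; a nonzero second factor makes the remaining coordinates
  small as well, which the unit length excludes.\<close>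

lemma phi_Suc_lower:
  assumes "length vs = j + 2" "set vs \<subseteq> Sph (Suc j)" "\<And>v. v \<in> set vs \<Longrightarrow> v (Suc j) \<le> 0"
    and "\<And>u v. u \<in> set vs \<Longrightarrow> v \<in> set vs \<Longrightarrow> close e u v"
    and "4 * (real (Suc j) + 1) * e\<^sup>2 < 1" "e \<ge> 0"
  shows "phi (Suc j) vs = cobd (preprim j) vs"
proof -
  obtain u v ws where vs: "vs = u # v # ws"
    using assms(1) by (auto simp: numeral_2_eq_2 length_Suc_conv)
  have "pos (Suc j) u * cobd (phi j) vs = 0"
  proof (rule ccontr)
    assume "pos (Suc j) u * cobd (phi j) vs \<noteq> 0"
    then have nz: "cobd (phi j) vs \<noteq> 0" and "u (Suc j) = 0"
      using assms(3)[of u] vs by (auto simp: pos_def split: if_splits)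
    have "\<bar>u i\<bar> \<le> 2 * e" if "i \<le> Suc j" for i
    proof (cases "i = Suc j")
      case True
      then show ?thesis using \<open>u (Suc j) = 0\<close> \<open>e \<ge> 0\<close> by simp
    next
      case False
      then have ij: "i \<le> j" using that by simp
      obtain v w where "v \<in> set vs" "w \<in> set vs" "pos i v \<noteq> pos i w"
        using cobd_phi_nonzero[OF assms(1) nz ij] by blast
      moreover have "u \<in> set vs" using vs by simp
      ultimately show ?thesis
        using pos_neq_close assms(4) by blast
    qed
    then show False using not_all_small[of u "Suc j" e] assms vs by auto
  qed
  then show ?thesis by (simp add: vs cobd_preprim del: cobd.simps phi.simps)
qed

lemma phi_Suc_upper:
  assumes "\<And>v. v \<in> set vs \<Longrightarrow> v (Suc j) \<ge> 0"
  shows "phi (Suc j) vs = 0"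
  using assms by (cases "(Suc j, vs)" rule: phi.cases) (auto simp: pos_def)

lemma phi_constant:
  assumes "j > 0" "set vs \<subseteq> {v}"
  shows "phi j vs = 0"
  using assms by (cases "(j, vs)" rule: phi.cases) auto

section \<open>Small tuples and cycles on the configuration space\<close>

definition conf :: "nat \<Rightarrow> nat \<Rightarrow> (nat \<Rightarrow> nat \<Rightarrow> real) set" where
  "conf n k = PiE {1..n} (\<lambda>_. Sph k)"

definition near :: "real \<Rightarrow> (nat \<Rightarrow> nat \<Rightarrow> real) \<Rightarrow> (nat \<Rightarrow> nat \<Rightarrow> real) \<Rightarrow> bool" where
  "near e x y \<longleftrightarrow> (\<forall>i. close e (x i) (y i))"

definition small_tuples :: "real \<Rightarrow> (nat \<Rightarrow> nat \<Rightarrow> real) set \<Rightarrow> nat \<Rightarrow> (nat \<Rightarrow> nat \<Rightarrow> real) list set" where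
  "small_tuples e X p =
     {xs. length xs = Suc p \<and> set xs \<subseteq> X \<and> (\<forall>x\<in>set xs. \<forall>y\<in>set xs. near e x y)}"

text \<open>A chain is represented by the functional that evaluates cochains on it.\<close>

definition is_cycle ::
  "real \<Rightarrow> (nat \<Rightarrow> nat \<Rightarrow> real) set \<Rightarrow> nat \<Rightarrow> (((nat \<Rightarrow> nat \<Rightarrow> real) list \<Rightarrow> int) \<Rightarrow> int) \<Rightarrow> bool" where
  "is_cycle e X p L \<longleftrightarrow>
     (\<forall>a c f g. L (\<lambda>xs. a * f xs + c * g xs) = a * L f + c * L g) \<and>
     (\<forall>f g. (\<forall>xs\<in>small_tuples e X p. f xs = g xs) \<longrightarrow> L f = L g) \<and>
     (\<forall>f. f [] = 0 \<longrightarrow> L (cobd f) = 0)"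

text \<open>Stated as invariance under maps that move only coordinate \<open>b\<close>, because
  \<open>set_coord\<close>, \<open>tilt\<close> and \<open>reflect\<close> are maps of this
  kind.\<close>

definition indep :: "nat \<Rightarrow> ((nat \<Rightarrow> nat \<Rightarrow> real) list \<Rightarrow> int) \<Rightarrow> bool" where
  "indep b f \<longleftrightarrow> (\<forall>h. (\<forall>x i. i \<noteq> b \<longrightarrow> h x i = x i) \<longrightarrow> (\<forall>xs. f (map h xs) = f xs))"

text \<open>Expresses that the chain becomes zero when coordinate \<open>b\<close> is forgotten. The
  cone on such a chain has no boundary at its apex.\<close>

definition kills_indep :: "nat \<Rightarrow> (((nat \<Rightarrow> nat \<Rightarrow> real) list \<Rightarrow> int) \<Rightarrow> int) \<Rightarrow> bool" where
  "kills_indep b L \<longleftrightarrow> (\<forall>f. indep b f \<longrightarrow> L f = 0)"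

definition on_coord :: "nat \<Rightarrow> ((nat \<Rightarrow> real) list \<Rightarrow> int) \<Rightarrow> (nat \<Rightarrow> nat \<Rightarrow> real) list \<Rightarrow> int" where
  "on_coord b f xs = f (map (\<lambda>x. x b) xs)"

text \<open>The stages of the iterated suspension: coordinate \<open>b\<close> runs through S^0,
  S^1, ..., S^k while the other coordinates range over the whole sphere.\<close>

definition slice :: "nat \<Rightarrow> nat \<Rightarrow> nat \<Rightarrow> nat \<Rightarrow> (nat \<Rightarrow> nat \<Rightarrow> real) set" where
  "slice n k b j = {x \<in> conf n k. x b \<in> Sph j}"

lemma is_cycle_cong:
  "is_cycle e X p L \<Longrightarrow> (\<And>xs. xs \<in> small_tuples e X p \<Longrightarrow> f xs = g xs) \<Longrightarrow> L f = L g"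
  unfolding is_cycle_def by blast

lemma is_cycle_linear: "is_cycle e X p L \<Longrightarrow> L (\<lambda>xs. a * f xs + c * g xs) = a * L f + c * L g"
  unfolding is_cycle_def by blast

lemma is_cycle_diff: "is_cycle e X p L \<Longrightarrow> L (\<lambda>xs. f xs - g xs) = L f - L g"
  using is_cycle_linear[of e X p L 1 f "-1" g] by simp

lemma is_cycle_scale: "is_cycle e X p L \<Longrightarrow> L (\<lambda>xs. a * f xs) = a * L f"
  using is_cycle_linear[of e X p L a f 0 f] by simp

lemma is_cycle_cobd: "is_cycle e X p L \<Longrightarrow> f [] = 0 \<Longrightarrow> L (cobd f) = 0"
  unfolding is_cycle_def by blast

lemma near_mono: "near e x y \<Longrightarrow> e \<le> e' \<Longrightarrow> near e' x y"
  unfolding near_def close_def by (meson order_trans)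

lemma is_cycle_mono:
  assumes L: "is_cycle e X p L" and "e \<le> e'" "X \<subseteq> X'"
  shows "is_cycle e' X' p L"
proof -
  have "small_tuples e X p \<subseteq> small_tuples e' X' p"
    using assms(2,3) near_mono unfolding small_tuples_def by blast
  then have "L f = L g" if "\<forall>xs\<in>small_tuples e' X' p. f xs = g xs" for f g
    using is_cycle_cong[OF L] that by blast
  with L show ?thesis
    unfolding is_cycle_def by simp
qed

lemma indep_map: "indep b f \<Longrightarrow> (\<And>x i. i \<noteq> b \<Longrightarrow> h x i = x i) \<Longrightarrow> f (map h xs) = f xs"
  unfolding indep_def by blast

lemma indep_cup: "indep b f \<Longrightarrow> indep b g \<Longrightarrow> indep b (cup m f g)"
  unfolding indep_def cup_def by (simp add: take_map drop_map)

lemma indep_diff: "indep b f \<Longrightarrow> indep b g \<Longrightarrow> indep b (\<lambda>xs. f xs - g xs)"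
  unfolding indep_def by auto

lemma indep_on_coord: "a \<noteq> b \<Longrightarrow> indep b (on_coord a f)"
  unfolding indep_def on_coord_def by (auto simp: comp_def)

lemma conf_upd: "x \<in> conf n k \<Longrightarrow> b \<in> {1..n} \<Longrightarrow> v \<in> Sph k \<Longrightarrow> x(b := v) \<in> conf n k"
  unfolding conf_def by (auto simp: PiE_iff extensional_def)

lemma Sph_mono:
  assumes "j \<le> k" shows "Sph j \<subseteq> Sph k"
proof
  fix v assume v: "v \<in> Sph j"
  have "(\<Sum>i\<le>k. (v i)\<^sup>2) = (\<Sum>i\<le>j. (v i)\<^sup>2)"
    by (rule sum.mono_neutral_right) (use v assms in \<open>auto simp: Sph_def\<close>)
  then show "v \<in> Sph k" using v assms by (auto simp: Sph_def)
qed

lemma Sph_abs_le_1: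
  assumes "v \<in> Sph k" shows "\<bar>v i\<bar> \<le> 1"
proof (cases "i \<le> k")
  case True
  then have "(v i)\<^sup>2 \<le> (\<Sum>i\<le>k. (v i)\<^sup>2)" by (intro member_le_sum) auto
  then show ?thesis using assms by (simp add: Sph_def abs_square_le_1)
next
  case False
  then show ?thesis using assms by (auto simp: Sph_def)
qed

section \<open>Deformations of a single sphere coordinate\<close>

definition axis_point :: "nat \<Rightarrow> real \<Rightarrow> nat \<Rightarrow> real" where
  "axis_point j s = (\<lambda>i. if i = j then s else 0)"

lemma axis_point_Sph: "\<bar>s\<bar> = 1 \<Longrightarrow> j \<le> k \<Longrightarrow> axis_point j s \<in> Sph k"
  by (auto simp: Sph_def axis_point_def if_distrib[of "\<lambda>x. x\<^sup>2"] abs_if split: if_splits cong: if_cong)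

definition set_coord :: "nat \<Rightarrow> (nat \<Rightarrow> real) \<Rightarrow> (nat \<Rightarrow> nat \<Rightarrow> real) \<Rightarrow> nat \<Rightarrow> nat \<Rightarrow> real" where
  "set_coord b v x = x(b := v)"

text \<open>Stage \<open>i\<close> of \<open>N\<close> of a quarter turn that takes the equator of
  coordinate \<open>b\<close> along the meridians to the south pole -e_j.\<close>

definition tilt :: "nat \<Rightarrow> nat \<Rightarrow> nat \<Rightarrow> nat \<Rightarrow> (nat \<Rightarrow> nat \<Rightarrow> real) \<Rightarrow> nat \<Rightarrow> nat \<Rightarrow> real" where
  "tilt N b j i x = x(b := (\<lambda>q. if q = j then - sin (pi / 2 * (i / N)) else cos (pi / 2 * (i / N)) * x b q))"

definition reflect :: "nat \<Rightarrow> nat \<Rightarrow> (nat \<Rightarrow> nat \<Rightarrow> real) \<Rightarrow> nat \<Rightarrow> nat \<Rightarrow> real" where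
  "reflect b j x = x(b := (x b)(j := - x b j))"

text \<open>The product with the reduced 0-cycle of S^0, from which the iterated suspension
  starts.\<close>

definition poles :: "nat \<Rightarrow> (((nat \<Rightarrow> nat \<Rightarrow> real) list \<Rightarrow> int) \<Rightarrow> int) \<Rightarrow> ((nat \<Rightarrow> nat \<Rightarrow> real) list \<Rightarrow> int) \<Rightarrow> int" where
  "poles b L f = L (\<lambda>xs. f (map (set_coord b (axis_point 0 1)) xs)) -
                 L (\<lambda>xs. f (map (set_coord b (axis_point 0 (-1))) xs))"

text \<open>A cycle over the equator is coned off to the south pole, and the mirror image of the cone is
  subtracted.\<close>

definition susp :: "nat \<Rightarrow> nat \<Rightarrow> nat \<Rightarrow> (((nat \<Rightarrow> nat \<Rightarrow> real) list \<Rightarrow> int) \<Rightarrow> int) \<Rightarrow> ((nat \<Rightarrow> nat \<Rightarrow> real) list \<Rightarrow> int) \<Rightarrow> int" where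
  "susp N b j L f = L (\<lambda>xs. hprism (tilt N b j) N (\<lambda>ys. f ys - f (map (reflect b j) ys)) xs)"

lemma near_refl: "e \<ge> 0 \<Longrightarrow> near e x x"
  by (simp add: near_def close_def)

lemma near_set_coord: "near e x y \<Longrightarrow> e \<ge> 0 \<Longrightarrow> near e (set_coord b v x) (set_coord b v y)"
  by (auto simp: near_def close_def set_coord_def)

lemma near_reflect: "near e x y \<Longrightarrow> near e (reflect b j x) (reflect b j y)"
  unfolding near_def close_def reflect_def
  by (metis (no_types, lifting) abs_minus_commute fun_upd_apply minus_diff_minus minus_diff_eq)

lemma abs_sin_diff_le: "\<bar>sin x - sin y\<bar> \<le> \<bar>x - y\<bar>" for x y :: real
proof -
  have "\<bar>sin x - sin y\<bar> = 2 * \<bar>sin ((x - y) / 2)\<bar> * \<bar>cos ((x + y) / 2)\<bar>"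
    by (simp add: sin_diff_sin abs_mult)
  also have "\<dots> \<le> 2 * \<bar>(x - y) / 2\<bar> * 1"
    by (intro mult_mono abs_sin_x_le_abs_x order_refl abs_cos_le_one) auto
  finally show ?thesis by simp
qed

lemma abs_cos_diff_le: "\<bar>cos x - cos y\<bar> \<le> \<bar>x - y\<bar>" for x y :: real
  using abs_sin_diff_le[of "pi / 2 - x" "pi / 2 - y"] by (simp add: sin_diff abs_minus_commute)

lemma near_tilt_same:
  assumes "near e x y" "e \<ge> 0"
  shows "near e (tilt N b j i x) (tilt N b j i y)"
proof -
  have "\<bar>c * u - c * v\<bar> \<le> e" if "\<bar>c\<bar> \<le> 1" "\<bar>u - v\<bar> \<le> e" for c u v :: real
  proof -
    have "\<bar>c * u - c * v\<bar> = \<bar>c\<bar> * \<bar>u - v\<bar>" by (simp add: abs_mult flip: right_diff_distrib)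
    also have "\<dots> \<le> 1 * \<bar>u - v\<bar>" by (intro mult_right_mono) (use that in auto)
    finally show ?thesis using that by simp
  qed
  with assms show ?thesis
    unfolding near_def close_def tilt_def by simp
qed

lemma near_tilt_step:
  assumes "pi / 2 / N \<le> d" "x b \<in> Sph l"
  shows "near d (tilt N b j i x) (tilt N b j (Suc i) x)"
proof -
  have d: "\<bar>pi / 2 * (i / N) - pi / 2 * (Suc i / N)\<bar> \<le> d"
  proof -
    have "pi / 2 * (i / N) - pi / 2 * (Suc i / N) = - (pi / 2 / N)"
      by (simp add: field_simps flip: add_divide_distrib)
    then show ?thesis using assms(1) by simp
  qed
  then have "d \<ge> 0" by linarith
  have *: "\<bar>cos (pi / 2 * (i / N)) * u - cos (pi / 2 * (Suc i / N)) * u\<bar> \<le> d" if "\<bar>u\<bar> \<le> 1" for u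
  proof -
    have "\<bar>cos (pi / 2 * (i / N)) * u - cos (pi / 2 * (Suc i / N)) * u\<bar>
        = \<bar>cos (pi / 2 * (i / N)) - cos (pi / 2 * (Suc i / N))\<bar> * \<bar>u\<bar>"
      by (simp only: abs_mult[symmetric] left_diff_distrib)
    also have "\<dots> \<le> d * 1"
      using abs_cos_diff_le[of "pi / 2 * (i / N)" "pi / 2 * (Suc i / N)"] d that \<open>d \<ge> 0\<close>
      by (intro mult_mono) linarith+
    finally show ?thesis by simp
  qed
  have "\<bar>sin (pi / 2 * (i / N)) - sin (pi / 2 * (Suc i / N))\<bar> \<le> d"
    using abs_sin_diff_le[of "pi / 2 * (i / N)" "pi / 2 * (Suc i / N)"] d by linarith
  then show ?thesis
    unfolding near_def close_def tilt_def
    using * Sph_abs_le_1[OF assms(2)] \<open>d \<ge> 0\<close> by (auto simp: abs_minus_commute)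
qed

lemma near_trans: "near d x y \<Longrightarrow> near e y z \<Longrightarrow> near (d + e) x z"
proof -
  assume *: "near d x y" "near e y z"
  have "\<bar>x i j - z i j\<bar> \<le> d + e" for i j
  proof -
    have "\<bar>x i j - y i j\<bar> \<le> d" "\<bar>y i j - z i j\<bar> \<le> e"
      using * unfolding near_def close_def by blast+
    then show ?thesis by linarith
  qed
  then show "near (d + e) x z"
    unfolding near_def close_def by blast
qed

lemma near_sym: "near d x y \<Longrightarrow> near d y x"
  unfolding near_def close_def by (simp add: abs_minus_commute)

lemma tilt_slice:
  assumes "x \<in> slice n k b j" "Suc j \<le> k" "b \<in> {1..n}" "i \<le> N"
  shows "tilt N b (Suc j) i x \<in> slice n k b (Suc j)" "tilt N b (Suc j) i x b (Suc j) \<le> 0"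
proof -
  let ?t = "pi / 2 * (i / N)"
  have x: "x b \<in> Sph j" "x \<in> conf n k" using assms by (auto simp: slice_def)
  let ?v = "\<lambda>q. if q = Suc j then - sin ?t else cos ?t * x b q"
  have "(\<Sum>q\<le>Suc j. (?v q)\<^sup>2) = (cos ?t)\<^sup>2 * (\<Sum>q\<le>j. (x b q)\<^sup>2) + (sin ?t)\<^sup>2"
    by (simp add: power_mult_distrib sum_distrib_left)
  also have "\<dots> = 1" using x by (simp add: Sph_def)
  finally have "?v \<in> Sph (Suc j)" using x by (simp add: Sph_def)
  then show "tilt N b (Suc j) i x \<in> slice n k b (Suc j)"
    using conf_upd[OF x(2) assms(3), of ?v] Sph_mono[OF assms(2)] by (auto simp: slice_def tilt_def)
  have "i / N \<le> 1" using assms(4) by (simp add: divide_le_eq)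
  then have "?t \<le> pi / 2 * 1" by (intro mult_left_mono) auto
  then have "?t \<le> pi" using pi_gt_zero by linarith
  moreover have "?t \<ge> 0" by simp
  ultimately have "sin ?t \<ge> 0" by (intro sin_ge_zero)
  then show "tilt N b (Suc j) i x b (Suc j) \<le> 0" by (simp add: tilt_def)
qed

lemma reflect_slice:
  assumes "x \<in> slice n k b j" "j \<le> k" "b \<in> {1..n}"
  shows "reflect b i x \<in> slice n k b j"
proof -
  have x: "x b \<in> Sph j" "x \<in> conf n k" using assms by (auto simp: slice_def)
  have "((x b)(i := - x b i)) \<in> Sph j"
  proof -
    have "(\<Sum>q\<le>j. (((x b)(i := - x b i)) q)\<^sup>2) = (\<Sum>q\<le>j. (x b q)\<^sup>2)"
      by (intro sum.cong) auto
    with x show ?thesis by (auto simp: Sph_def)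
  qed
  then show ?thesis
    using conf_upd[OF x(2) assms(3), of "(x b)(i := - x b i)"] Sph_mono[OF assms(2)]
    by (auto simp: slice_def reflect_def)
qed

lemma tilt_0: "x b j = 0 \<Longrightarrow> tilt N b j 0 x = x"
  by (auto simp: tilt_def fun_eq_iff)

lemma tilt_N:
  assumes "N > 0" shows "tilt N b j N = set_coord b (axis_point j (-1))"
  using assms by (auto simp: tilt_def set_coord_def axis_point_def fun_eq_iff)

lemma set_coord_absorb: "(\<And>x i. i \<noteq> b \<Longrightarrow> h x i = x i) \<Longrightarrow> set_coord b v (h x) = set_coord b v x"
  by (auto simp: set_coord_def fun_eq_iff)

lemma indep_set_coord: "indep b (\<lambda>xs. f (map (set_coord b v) xs))"
  unfolding indep_def by (auto simp: set_coord_absorb comp_def)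

text \<open>A prism joins two consecutive stages over the same tuple, so its spread is the old one
  plus one step of the quarter turn, whence \<open>e + d\<close>.\<close>

lemma tilt_prism_tuple:
  assumes xs: "xs \<in> small_tuples e (slice n k b j) p" and k: "Suc j \<le> k" "b \<in> {1..n}"
    and i: "i < N" and d: "pi / 2 / N \<le> d" and e: "e \<ge> 0"
    and ys: "set ys \<subseteq> tilt N b (Suc j) i ` set xs \<union> tilt N b (Suc j) (Suc i) ` set xs"
      "length ys = Suc (length xs)"
  shows "ys \<in> small_tuples (e + d) (slice n k b (Suc j)) (Suc p)" "\<And>y. y \<in> set ys \<Longrightarrow> y b (Suc j) \<le> 0"
proof -
  let ?h = "tilt N b (Suc j)"
  have sl: "x \<in> slice n k b j" if "x \<in> set xs" for x using xs that by (auto simp: small_tuples_def)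
  have d0: "d \<ge> 0" using d by (rule order_trans[rotated]) simp
  have ne: "near e x y" if "x \<in> set xs" "y \<in> set xs" for x y
    using xs that by (auto simp: small_tuples_def)
  have cross: "near (e + d) (?h i x) (?h (Suc i) y)" if "x \<in> set xs" "y \<in> set xs" for x y
    by (rule near_trans[OF near_tilt_same[OF ne[OF that] e] near_tilt_step[OF d]])
      (use sl[OF that(2)] in \<open>auto simp: slice_def\<close>)
  have same: "near (e + d) (?h l x) (?h l y)" if "x \<in> set xs" "y \<in> set xs" for x y l
    using near_trans[OF near_tilt_same[OF ne[OF that] e] near_refl[OF d0]] .
  have "near (e + d) u v" if uv: "u \<in> set ys" "v \<in> set ys" for u v
  proof -
    have "u \<in> ?h i ` set xs \<or> u \<in> ?h (Suc i) ` set xs" "v \<in> ?h i ` set xs \<or> v \<in> ?h (Suc i) ` set xs"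
      using uv ys by auto
    then show ?thesis
      using cross same near_sym by blast
  qed
  moreover have "u \<in> slice n k b (Suc j) \<and> u b (Suc j) \<le> 0" if "u \<in> set ys" for u
  proof -
    have "u \<in> ?h i ` set xs \<or> u \<in> ?h (Suc i) ` set xs" using that ys(1) by auto
    moreover have "i \<le> N" "Suc i \<le> N" using i by auto
    ultimately obtain x l where "x \<in> set xs" "l \<le> N" "u = ?h l x" by blast
    then show ?thesis
      using tilt_slice[OF sl k, of x l N] by simp
  qed
  ultimately show "ys \<in> small_tuples (e + d) (slice n k b (Suc j)) (Suc p)"
    and "\<And>y. y \<in> set ys \<Longrightarrow> y b (Suc j) \<le> 0"
    using xs ys(2) by (auto simp: small_tuples_def)
qed

section \<open>Suspending a cycle along one coordinate\<close>

lemma is_cycle_zero: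
  assumes "is_cycle e X p L" "\<And>xs. xs \<in> small_tuples e X p \<Longrightarrow> f xs = 0"
  shows "L f = 0"
proof -
  have "L f = L (\<lambda>xs. 0 * f xs)"
    by (rule is_cycle_cong[OF assms(1)]) (simp add: assms(2))
  then show ?thesis
    using is_cycle_scale[OF assms(1), of 0 f] by simp
qed

lemma small_tuples_map:
  assumes "xs \<in> small_tuples e X p" "\<And>x. x \<in> X \<Longrightarrow> h x \<in> X'"
    and "\<And>x y. near e x y \<Longrightarrow> near e (h x) (h y)"
  shows "map h xs \<in> small_tuples e X' p"
  using assms by (auto simp: small_tuples_def subset_iff)

lemma small_tuples_mono:
  assumes "xs \<in> small_tuples e X p" "e \<le> e'" "X \<subseteq> X'"
  shows "xs \<in> small_tuples e' X' p"
  using assms near_mono unfolding small_tuples_def by blast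

lemma small_tuples_sub:
  assumes "xs \<in> small_tuples e X p" "set ys \<subseteq> set xs" "length ys = Suc q"
  shows "ys \<in> small_tuples e X q"
  using assms unfolding small_tuples_def by blast

lemma small_tuples_take:
  assumes "xs \<in> small_tuples e X p" "q \<le> p"
  shows "take (Suc q) xs \<in> small_tuples e X q"
  by (rule small_tuples_sub[OF assms(1) set_take_subset]) (use assms in \<open>simp add: small_tuples_def\<close>)

lemma small_tuples_drop:
  assumes "xs \<in> small_tuples e X (m + q)"
  shows "drop m xs \<in> small_tuples e X q"
  by (rule small_tuples_sub[OF assms(1) set_drop_subset]) (use assms in \<open>simp add: small_tuples_def\<close>)

lemma slice_0: "x \<in> slice n k b j \<Longrightarrow> x b (Suc j) = 0"
  by (auto simp: slice_def Sph_def)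

lemma phi_cocycle_on_coord:
  assumes "ys \<in> small_tuples e (slice n k b j) (Suc j)" "4 * (real j + 1) * e\<^sup>2 < 1"
  shows "cobd (on_coord b (phi j)) ys = 0"
proof -
  have "cobd (phi j) (map (\<lambda>x. x b) ys) = 0"
    by (rule phi_cocycle[OF _ _ _ assms(2)])
      (use assms(1) in \<open>auto simp: small_tuples_def slice_def near_def\<close>)
  then show ?thesis by (simp add: cobd_map on_coord_def[abs_def])
qed

context
  fixes n k b j p N :: nat and e d :: real and L
  assumes L: "is_cycle e (slice n k b j) p L" and K: "kills_indep b L"
    and j: "Suc j \<le> k" and b: "b \<in> {1..n}" and N: "N > 0" "pi / 2 / N \<le> d" and e: "e \<ge> 0"
begin

private abbreviation "h \<equiv> tilt N b (Suc j)"

lemma hprism_tilt_cong: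
  assumes "\<And>ys. ys \<in> small_tuples (e + d) (slice n k b (Suc j)) (Suc p) \<Longrightarrow>
             (\<And>y. y \<in> set ys \<Longrightarrow> y b (Suc j) \<le> 0) \<Longrightarrow> F ys = G ys"
  shows "L (hprism h N F) = L (hprism h N G)"
  by (rule is_cycle_cong[OF L], rule hprism_cong, rule assms)
    (auto dest: tilt_prism_tuple[OF _ j b _ N(2) e])

text \<open>The boundary of the cone is minus its base. The homotopy formula leaves both ends; at
  the apex coordinate \<open>b\<close> is constant, so \<open>A\<close> becomes independent of it
  there and \<open>kills_indep\<close> removes this end.\<close>

lemma hprism_tilt_cobd:
  assumes "A [] = 0"
  shows "L (hprism h N (cobd A)) = - L A"
proof -
  have "hprism h N (cobd A) = (\<lambda>xs. (A (map (h N) xs) - A (map (h 0) xs)) - cobd (hprism h N A) xs)"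
    using hprism_homotopy[of h N A] by (auto simp: fun_eq_iff algebra_simps)
  then have "L (hprism h N (cobd A)) = L (\<lambda>xs. A (map (h N) xs)) - L (\<lambda>xs. A (map (h 0) xs))
      - L (cobd (hprism h N A))"
    by (simp add: is_cycle_diff[OF L])
  moreover have "L (cobd (hprism h N A)) = 0"
    by (rule is_cycle_cobd[OF L]) simp
  moreover have "L (\<lambda>xs. A (map (h N) xs)) = 0"
    using K indep_set_coord[of b A] by (simp add: kills_indep_def tilt_N[OF N(1)])
  moreover have "L (\<lambda>xs. A (map (h 0) xs)) = L A"
  proof (rule is_cycle_cong[OF L])
    fix xs assume "xs \<in> small_tuples e (slice n k b j) p"
    then have "map (h 0) xs = xs"
      by (intro map_idI tilt_0 slice_0[of _ n k]) (auto simp: small_tuples_def)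
    then show "A (map (h 0) xs) = A xs" by simp
  qed
  ultimately show ?thesis by simp
qed

text \<open>A cochain that ignores coordinate \<open>b\<close> cannot tell the cone from its mirror
  image.\<close>

lemma susp_kills_indep: "kills_indep b (susp N b (Suc j) L)"
  unfolding kills_indep_def
proof (intro allI impI)
  fix f assume "indep b f"
  then have "f (map (reflect b (Suc j)) ys) = f ys" for ys
    by (rule indep_map) (simp add: reflect_def)
  then show "susp N b (Suc j) L f = 0"
    unfolding susp_def by (intro is_cycle_zero[OF L]) (use hprism_linear[of h N 0 f 0 f] in simp)
qed

text \<open>Both cones have the same boundary, since \<open>reflect\<close> fixes the equator
  pointwise, and they enter with opposite signs.\<close>

lemma susp_is_cycle: "is_cycle (e + d) (slice n k b (Suc j)) (Suc p) (susp N b (Suc j) L)"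
  unfolding is_cycle_def
proof (intro conjI allI impI)
  let ?r = "map (reflect b (Suc j))"
  fix a c :: int and f g
  have "(\<lambda>ys. (a * f ys + c * g ys) - (a * f (?r ys) + c * g (?r ys)))
      = (\<lambda>ys. a * (f ys - f (?r ys)) + c * (g ys - g (?r ys)))"
    by (auto simp: algebra_simps)
  then show "susp N b (Suc j) L (\<lambda>xs. a * f xs + c * g xs) = a * susp N b (Suc j) L f + c * susp N b (Suc j) L g"
    by (simp only: susp_def hprism_linear is_cycle_linear[OF L])
next
  fix f g assume fg: "\<forall>xs\<in>small_tuples (e + d) (slice n k b (Suc j)) (Suc p). f xs = (g xs :: int)"
  show "susp N b (Suc j) L f = susp N b (Suc j) L g"
    unfolding susp_def
  proof (rule hprism_tilt_cong)
    fix ys assume "ys \<in> small_tuples (e + d) (slice n k b (Suc j)) (Suc p)"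
    moreover from this have "map (reflect b (Suc j)) ys \<in> small_tuples (e + d) (slice n k b (Suc j)) (Suc p)"
      by (rule small_tuples_map) (use reflect_slice j b near_reflect in auto)
    ultimately show "f ys - f (map (reflect b (Suc j)) ys) = g ys - g (map (reflect b (Suc j)) ys)"
      using fg by simp
  qed
next
  let ?r = "map (reflect b (Suc j))"
  fix f :: "(nat \<Rightarrow> nat \<Rightarrow> real) list \<Rightarrow> int" assume f: "f [] = 0"
  let ?F = "\<lambda>ys. f ys - f (?r ys)"
  have "susp N b (Suc j) L (cobd f) = L (hprism h N (cobd ?F))"
    by (simp add: susp_def cobd_map cobd_diff[abs_def])
  also have "\<dots> = - L ?F"
    by (rule hprism_tilt_cobd) simp
  also have "L ?F = 0"
  proof (rule is_cycle_zero[OF L])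
    fix xs assume "xs \<in> small_tuples e (slice n k b j) p"
    then have "?r xs = xs"
      by (intro map_idI) (auto simp: small_tuples_def reflect_def fun_eq_iff dest: slice_0 subsetD)
    then show "?F xs = 0" by simp
  qed
  finally show "susp N b (Suc j) L (cobd f) = 0" by simp
qed

text \<open>This is where the convention counts that \<open>pos\<close> is 1 at the value 0.\<close>

lemma preprim_on_equator:
  assumes "xs \<in> small_tuples e (slice n k b j) q"
  shows "on_coord b (preprim j) xs = on_coord b (phi j) xs"
proof -
  obtain x ys where "xs = x # ys" "x \<in> slice n k b j"
    using assms by (cases xs) (auto simp: small_tuples_def)
  then show ?thesis
    by (simp add: on_coord_def preprim_def pos_def slice_0)
qed

lemma phi_upper_reflect:
  assumes "\<And>y. y \<in> set ys \<Longrightarrow> y b (Suc j) \<le> 0"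
  shows "on_coord b (phi (Suc j)) (map (reflect b (Suc j)) ys) = 0"
  unfolding on_coord_def by (rule phi_Suc_upper) (use assms in \<open>auto simp: reflect_def\<close>)

lemma phi_lower:
  assumes "ys \<in> small_tuples (e + d) (slice n k b (Suc j)) (Suc j)"
    "\<And>y. y \<in> set ys \<Longrightarrow> y b (Suc j) \<le> 0" "4 * (real k + 1) * (e + d)\<^sup>2 < 1"
  shows "cobd (on_coord b (preprim j)) ys = on_coord b (phi (Suc j)) ys"
proof -
  have "d \<ge> 0" using N(2) by (rule order_trans[rotated]) simp
  have "4 * (real (Suc j) + 1) * (e + d)\<^sup>2 \<le> 4 * (real k + 1) * (e + d)\<^sup>2"
    using j by (intro mult_right_mono) auto
  then have "phi (Suc j) (map (\<lambda>x. x b) ys) = cobd (preprim j) (map (\<lambda>x. x b) ys)"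
    by (intro phi_Suc_lower[where e = "e + d"])
      (use assms e \<open>d \<ge> 0\<close> in \<open>auto simp: small_tuples_def slice_def near_def\<close>)
  then show ?thesis by (simp add: cobd_map on_coord_def[abs_def])
qed

text \<open>The mirrored cone lies in the upper hemisphere and contributes nothing. On the other
  cone \<open>psi\<close> is a cocycle, so the product is (-1)^m times the coboundary of
  \<open>psi\<close> times \<open>preprim j\<close>. The value is therefore taken on the base, up to
  the sign from \<open>hprism_tilt_cobd\<close>, and on the base \<open>preprim j\<close> is
  \<open>phi j\<close>.\<close>

lemma susp_cup_right:
  assumes p: "p = m + j" and psi: "psi [] = 0"
    and cocycle: "\<And>xs. xs \<in> small_tuples (e + d) (conf n k) (Suc m) \<Longrightarrow> cobd psi xs = 0"
    and small: "4 * (real k + 1) * (e + d)\<^sup>2 < 1"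
  shows "susp N b (Suc j) L (cup m psi (on_coord b (phi (Suc j)))) =
           - ((-1) ^ m * L (cup m psi (on_coord b (phi j))))"
proof -
  let ?A = "cup m psi (on_coord b (preprim j))"
  let ?P = "cup m psi (on_coord b (phi (Suc j)))"
  have "susp N b (Suc j) L ?P = L (hprism h N (\<lambda>ys. (-1) ^ m * cobd ?A ys))"
    unfolding susp_def
  proof (rule hprism_tilt_cong)
    fix ys assume ys: "ys \<in> small_tuples (e + d) (slice n k b (Suc j)) (Suc p)"
      and le: "\<And>y. y \<in> set ys \<Longrightarrow> y b (Suc j) \<le> 0"
    have "drop m ys \<in> small_tuples (e + d) (slice n k b (Suc j)) (Suc j)"
      by (rule small_tuples_drop) (use ys p in simp)
    then have 1: "cobd (on_coord b (preprim j)) (drop m ys) = on_coord b (phi (Suc j)) (drop m ys)"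
      by (rule phi_lower[OF _ _ small]) (use le in \<open>auto dest: in_set_dropD\<close>)
    have "take (Suc (Suc m)) ys \<in> small_tuples (e + d) (slice n k b (Suc j)) (Suc m)"
      by (rule small_tuples_take[OF ys]) (use p in simp)
    then have 2: "cobd psi (take (Suc (Suc m)) ys) = 0"
      by (intro cocycle) (auto elim: small_tuples_mono simp: slice_def)
    have 3: "?P (map (reflect b (Suc j)) ys) = 0"
      using phi_upper_reflect[of "drop m ys"] le by (auto simp: cup_def drop_map dest: in_set_dropD)
    have "cobd ?A ys = cup (Suc m) (cobd psi) (on_coord b (preprim j)) ys
        + (-1) ^ m * cup m psi (cobd (on_coord b (preprim j))) ys"
      by (rule cobd_cup) (use ys p in \<open>simp add: small_tuples_def\<close>)
    also have "\<dots> = (-1) ^ m * ?P ys"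
      by (simp add: cup_def 1 2)
    finally show "?P ys - ?P (map (reflect b (Suc j)) ys) = (-1) ^ m * cobd ?A ys"
      by (simp add: 3)
  qed
  also have "\<dots> = (-1) ^ m * L (hprism h N (cobd ?A))"
  proof -
    have "hprism h N (\<lambda>ys. (-1) ^ m * cobd ?A ys) = (\<lambda>xs. (-1) ^ m * hprism h N (cobd ?A) xs)"
      using hprism_linear[of h N "(-1) ^ m" "cobd ?A" 0 "cobd ?A"] by auto
    then show ?thesis
      by (simp only: is_cycle_scale[OF L])
  qed
  also have "L (hprism h N (cobd ?A)) = - L ?A"
    by (rule hprism_tilt_cobd) (simp add: cup_def psi)
  also have "L ?A = L (cup m psi (on_coord b (phi j)))"
  proof (rule is_cycle_cong[OF L])
    fix xs assume "xs \<in> small_tuples e (slice n k b j) p"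
    then show "?A xs = cup m psi (on_coord b (phi j)) xs"
      using preprim_on_equator[OF small_tuples_drop] by (simp add: cup_def p)
  qed
  finally show ?thesis by simp
qed

text \<open>As for \<open>susp_cup_right\<close>, but now the primitive is the first factor, so the
  Leibniz rule brings in no sign.\<close>

lemma susp_cup_left:
  assumes p: "p = j + m" and psi: "psi [] = 0"
    and cocycle: "\<And>xs. xs \<in> small_tuples (e + d) (conf n k) (Suc m) \<Longrightarrow> cobd psi xs = 0"
    and small: "4 * (real k + 1) * (e + d)\<^sup>2 < 1"
  shows "susp N b (Suc j) L (cup (Suc j) (on_coord b (phi (Suc j))) psi) =
           - L (cup j (on_coord b (phi j)) psi)"
proof -
  let ?A = "cup j (on_coord b (preprim j)) psi"
  let ?P = "cup (Suc j) (on_coord b (phi (Suc j))) psi"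
  have "susp N b (Suc j) L ?P = L (hprism h N (cobd ?A))"
    unfolding susp_def
  proof (rule hprism_tilt_cong)
    fix ys assume ys: "ys \<in> small_tuples (e + d) (slice n k b (Suc j)) (Suc p)"
      and le: "\<And>y. y \<in> set ys \<Longrightarrow> y b (Suc j) \<le> 0"
    have "take (Suc (Suc j)) ys \<in> small_tuples (e + d) (slice n k b (Suc j)) (Suc j)"
      by (rule small_tuples_take[OF ys]) (use p in simp)
    then have 1: "cobd (on_coord b (preprim j)) (take (Suc (Suc j)) ys) = on_coord b (phi (Suc j)) (take (Suc (Suc j)) ys)"
      by (rule phi_lower[OF _ _ small]) (use le in \<open>auto dest: in_set_takeD\<close>)
    have "drop j ys \<in> small_tuples (e + d) (slice n k b (Suc j)) (Suc m)"
      by (rule small_tuples_drop) (use ys p in simp)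
    then have 2: "cobd psi (drop j ys) = 0"
      by (intro cocycle) (auto elim: small_tuples_mono simp: slice_def)
    have 3: "?P (map (reflect b (Suc j)) ys) = 0"
      using phi_upper_reflect[of "take (Suc (Suc j)) ys"] le
      by (auto simp: cup_def take_map dest: in_set_takeD simp del: take_Suc)
    have "cobd ?A ys = cup (Suc j) (cobd (on_coord b (preprim j))) psi ys
        + (-1) ^ j * cup j (on_coord b (preprim j)) (cobd psi) ys"
      by (rule cobd_cup) (use ys p in \<open>simp add: small_tuples_def\<close>)
    also have "\<dots> = ?P ys"
      by (simp add: cup_def 1 2)
    finally show "?P ys - ?P (map (reflect b (Suc j)) ys) = cobd ?A ys"
      by (simp add: 3)
  qed
  also have "L (hprism h N (cobd ?A)) = - L ?A"
    by (rule hprism_tilt_cobd) (simp add: cup_def psi)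
  also have "L ?A = L (cup j (on_coord b (phi j)) psi)"
  proof (rule is_cycle_cong[OF L])
    fix xs assume "xs \<in> small_tuples e (slice n k b j) p"
    from small_tuples_take[OF this, of j]
    show "?A xs = cup j (on_coord b (phi j)) psi xs"
      by (simp add: cup_def p preprim_on_equator)
  qed
  finally show ?thesis .
qed

end

section \<open>Products with the fundamental cycle of a sphere\<close>

lemma poles_kills_indep: "kills_indep b (poles b L)"
  unfolding kills_indep_def poles_def
proof (intro allI impI)
  fix f assume "indep b f"
  then have "f (map (set_coord b v) xs) = f xs" for v xs
    by (rule indep_map) (simp add: set_coord_def)
  then show "L (\<lambda>xs. f (map (set_coord b (axis_point 0 1)) xs)) -
    L (\<lambda>xs. f (map (set_coord b (axis_point 0 (-1))) xs)) = 0" by simp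
qed

lemma map_set_coord_small:
  assumes "xs \<in> small_tuples e (conf n k) p" "b \<in> {1..n}" "j \<le> k" "v \<in> Sph j" "e \<ge> 0"
  shows "map (set_coord b v) xs \<in> small_tuples e (slice n k b j) p"
proof (rule small_tuples_map[OF assms(1)])
  fix x assume "x \<in> conf n k"
  then show "set_coord b v x \<in> slice n k b j"
    using conf_upd[of x n k b v] assms(2-4) Sph_mono[of j k] by (auto simp: slice_def set_coord_def)
qed (simp add: near_set_coord assms)

lemma pushforward_is_cycle:
  assumes L: "is_cycle e X p L" and h: "\<And>xs. xs \<in> small_tuples e X p \<Longrightarrow> map h xs \<in> small_tuples e X' p"
  shows "is_cycle e X' p (\<lambda>f. L (\<lambda>xs. f (map h xs)))"
  unfolding is_cycle_def
proof (intro conjI allI impI)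
  fix f g assume "\<forall>xs\<in>small_tuples e X' p. f xs = (g xs :: int)"
  then show "L (\<lambda>xs. f (map h xs)) = L (\<lambda>xs. g (map h xs))"
    by (intro is_cycle_cong[OF L]) (simp add: h)
next
  fix f :: "(nat \<Rightarrow> nat \<Rightarrow> real) list \<Rightarrow> int" assume "f [] = 0"
  then show "L (\<lambda>xs. cobd f (map h xs)) = 0"
    using is_cycle_cobd[OF L, of "\<lambda>xs. f (map h xs)"] by (simp add: cobd_map)
qed (simp add: is_cycle_linear[OF L])

lemma diff_is_cycle:
  assumes L: "is_cycle e X p L" and M: "is_cycle e X p M"
  shows "is_cycle e X p (\<lambda>f. L f - M f)"
  unfolding is_cycle_def
proof (intro conjI allI impI)
  fix f g assume "\<forall>xs\<in>small_tuples e X p. f xs = (g xs :: int)"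
  then show "L f - M f = L g - M g"
    using is_cycle_cong[OF L, of f g] is_cycle_cong[OF M, of f g] by simp
qed (auto simp: is_cycle_linear[OF L] is_cycle_linear[OF M] is_cycle_cobd[OF L] is_cycle_cobd[OF M] algebra_simps)

lemma poles_is_cycle:
  assumes "is_cycle e (conf n k) p L" "b \<in> {1..n}" "e \<ge> 0"
  shows "is_cycle e (slice n k b 0) p (poles b L)"
proof -
  have "axis_point 0 1 \<in> Sph 0" "axis_point 0 (-1) \<in> Sph 0" by (auto intro: axis_point_Sph)
  then show ?thesis
    unfolding poles_def[abs_def]
    by (intro diff_is_cycle pushforward_is_cycle[OF assms(1)] map_set_coord_small) (use assms in auto)
qed

text \<open>H_0 is 1 at e_0 and 0 at -e_0, so only the positive pole contributes.\<close>

lemma poles_cup: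
  assumes L: "is_cycle e (conf n k) p L" and psi: "indep b psi"
  shows "poles b L (cup p psi (on_coord b (phi 0))) = L psi"
    and "poles b L (cup 0 (on_coord b (phi 0)) psi) = L psi"
proof -
  have ps: "psi (map (set_coord b v) xs) = psi xs" for v xs
    using psi by (rule indep_map) (simp add: set_coord_def)
  have R: "cup p psi (on_coord b (phi 0)) (map (set_coord b v) xs) = pos 0 v * psi xs"
    if "xs \<in> small_tuples e (conf n k) p" for v xs
  proof -
    have "length xs = Suc p" using that by (simp add: small_tuples_def)
    then have "drop p xs = [last xs]"
      by (metis Cons_nth_drop_Suc Suc_n_not_le_n drop_all last_conv_nth diff_Suc_1 length_0_conv lessI nat.simps(3) order_refl)
    then show ?thesis
      using \<open>length xs = Suc p\<close> ps by (simp add: cup_def on_coord_def drop_map set_coord_def)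
  qed
  have Lf: "cup 0 (on_coord b (phi 0)) psi (map (set_coord b v) xs) = pos 0 v * psi xs"
    if xs: "xs \<in> small_tuples e (conf n k) p" for v xs
  proof -
    obtain x ys where "xs = x # ys" using xs by (cases xs) (auto simp: small_tuples_def)
    then show ?thesis
      using ps[of v xs] by (simp add: cup_def on_coord_def set_coord_def)
  qed
  have *: "L (\<lambda>xs. F (map (set_coord b v) xs)) = pos 0 v * L psi"
    if "\<And>xs. xs \<in> small_tuples e (conf n k) p \<Longrightarrow> F (map (set_coord b v) xs) = pos 0 v * psi xs" for F v
    using is_cycle_cong[OF L, of "\<lambda>xs. F (map (set_coord b v) xs)" "\<lambda>xs. pos 0 v * psi xs"] that
      is_cycle_scale[OF L] by simp
  have "L (\<lambda>xs. cup p psi (on_coord b (phi 0)) (map (set_coord b v) xs)) = pos 0 v * L psi" for v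
    by (rule *) (rule R)
  then show "poles b L (cup p psi (on_coord b (phi 0))) = L psi"
    unfolding poles_def by (simp add: pos_def axis_point_def)
  have "L (\<lambda>xs. cup 0 (on_coord b (phi 0)) psi (map (set_coord b v) xs)) = pos 0 v * L psi" for v
    by (rule *) (rule Lf)
  then show "poles b L (cup 0 (on_coord b (phi 0)) psi) = L psi"
    unfolding poles_def by (simp add: pos_def axis_point_def)
qed

text \<open>\<open>M\<close> plays the role of the product of \<open>L\<close> with the fundamental
  cycle of the sphere in coordinate \<open>b\<close>. Each of the k suspensions contributes
  (-1)^(p+1) when \<open>phi k\<close> is the right factor and -1 when it is the left one. Both
  orders are kept because the square of a difference class contains both.\<close>

proposition extend_cycle:
  assumes L: "is_cycle e (conf n k) p L" and e: "0 \<le> e" "e < E" and E: "4 * (real k + 1) * E\<^sup>2 < 1"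
    and b: "b \<in> {1..n}"
  obtains M where "is_cycle E (conf n k) (p + k) M" "kills_indep b M"
    "\<forall>psi. indep b psi \<and> psi [] = 0 \<and> (\<forall>xs\<in>small_tuples E (conf n k) (Suc p). cobd psi xs = 0)
       \<longrightarrow> M (cup p psi (on_coord b (phi k))) = (-1) ^ (k * Suc p) * L psi \<and>
           M (cup k (on_coord b (phi k)) psi) = (-1) ^ k * L psi"
proof -
  \<comment> \<open>The allowance from \<open>e\<close> to \<open>E\<close> is shared among k
    suspensions; the denominator k + 1 is positive also for k = 0.\<close>
  define d where "d = (E - e) / (real k + 1)"
  have d: "d > 0" using e by (simp add: d_def)
  obtain N :: nat where N: "N > 0" "pi / 2 / N \<le> d"
  proof -
    obtain N :: nat where N: "pi / 2 / d < N" using reals_Archimedean2 by blast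
    moreover have "pi / 2 / d > 0" using d by simp
    ultimately have "N > 0" by linarith
    moreover have "pi / 2 / N \<le> d" using N d \<open>N > 0\<close> by (simp add: field_simps)
    ultimately show ?thesis using that by blast
  qed
  have "\<exists>M. is_cycle (e + j * d) (slice n k b j) (p + j) M \<and> kills_indep b M \<and>
     (\<forall>psi. indep b psi \<longrightarrow> psi [] = 0 \<longrightarrow> (\<forall>xs\<in>small_tuples E (conf n k) (Suc p). cobd psi xs = 0) \<longrightarrow>
        M (cup p psi (on_coord b (phi j))) = (-1) ^ (j * Suc p) * L psi \<and>
        M (cup j (on_coord b (phi j)) psi) = (-1) ^ j * L psi)" if "j \<le> k" for j
    using that
  proof (induction j)
    case 0
    show ?case
      by (rule exI[of _ "poles b L"])
        (auto simp: poles_is_cycle[OF L b e(1)] poles_kills_indep poles_cup[OF L])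
  next
    case (Suc j)
    then obtain M where M: "is_cycle (e + j * d) (slice n k b j) (p + j) M" "kills_indep b M"
      and eval: "\<And>psi. \<lbrakk>indep b psi; psi [] = 0; \<forall>xs\<in>small_tuples E (conf n k) (Suc p). cobd psi xs = 0\<rbrakk>
        \<Longrightarrow> M (cup p psi (on_coord b (phi j))) = (-1) ^ (j * Suc p) * L psi \<and>
            M (cup j (on_coord b (phi j)) psi) = (-1) ^ j * L psi"
      by auto
    have ej: "e + j * d \<ge> 0" using e d by simp
    have "e + Suc j * d \<le> e + (real k + 1) * d"
      using Suc.prems d by (intro add_left_mono mult_right_mono) auto
    also have "\<dots> = E" by (simp add: d_def field_simps)
    finally have le: "e + j * d + d \<le> E" by (simp add: algebra_simps)
    have "(e + j * d + d)\<^sup>2 \<le> E\<^sup>2"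
      using le ej d by (intro power_mono) auto
    then have "4 * (real k + 1) * (e + j * d + d)\<^sup>2 \<le> 4 * (real k + 1) * E\<^sup>2"
      by (intro mult_left_mono) auto
    then have sm: "4 * (real k + 1) * (e + j * d + d)\<^sup>2 < 1" using E by linarith
    note ctx = M Suc.prems b N ej
    have "susp N b (Suc j) M (cup p psi (on_coord b (phi (Suc j)))) = (-1) ^ (Suc j * Suc p) * L psi \<and>
        susp N b (Suc j) M (cup (Suc j) (on_coord b (phi (Suc j))) psi) = (-1) ^ Suc j * L psi"
      if psi: "indep b psi" "psi [] = 0" "\<forall>xs\<in>small_tuples E (conf n k) (Suc p). cobd psi xs = 0" for psi
    proof -
      have co: "cobd psi xs = 0" if "xs \<in> small_tuples (e + j * d + d) (conf n k) (Suc p)" for xs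
        using psi(3) small_tuples_mono[OF that le order_refl] by blast
      show ?thesis
        using susp_cup_right[OF ctx refl psi(2) co sm] susp_cup_left[OF ctx add.commute psi(2) co sm]
          eval[OF psi] by (simp add: power_add)
    qed
    moreover have "is_cycle (e + Suc j * d) (slice n k b (Suc j)) (p + Suc j) (susp N b (Suc j) M)"
      using susp_is_cycle[OF ctx] by (simp add: algebra_simps)
    ultimately show ?case
      using susp_kills_indep[OF ctx] by blast
  qed
  from this[OF order_refl] obtain M where M: "is_cycle (e + k * d) (slice n k b k) (p + k) M" "kills_indep b M"
    and eval: "\<And>psi. \<lbrakk>indep b psi; psi [] = 0; \<forall>xs\<in>small_tuples E (conf n k) (Suc p). cobd psi xs = 0\<rbrakk>
        \<Longrightarrow> M (cup p psi (on_coord b (phi k))) = (-1) ^ (k * Suc p) * L psi \<and>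
            M (cup k (on_coord b (phi k)) psi) = (-1) ^ k * L psi"
    by blast
  have "e + k * d \<le> e + (real k + 1) * d" using d by simp
  also have "\<dots> = E" by (simp add: d_def field_simps)
  finally have "is_cycle E (conf n k) (p + k) M"
    by (intro is_cycle_mono[OF M(1)]) (auto simp: slice_def)
  then show ?thesis
    using M(2) eval by (intro that) auto
qed

section \<open>Products of difference classes\<close>

definition diff_class :: "nat \<Rightarrow> nat \<Rightarrow> (nat \<Rightarrow> nat \<Rightarrow> real) list \<Rightarrow> int" where
  "diff_class k b xs = on_coord b (phi k) xs - on_coord 1 (phi k) xs"

text \<open>The empty product is the unit cochain, set to 0 at \<open>[]\<close> because of the
  augmented coboundary.\<close>

fun cup_prod :: "nat \<Rightarrow> (nat \<Rightarrow> 'a list \<Rightarrow> int) \<Rightarrow> nat \<Rightarrow> 'a list \<Rightarrow> int" where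
  "cup_prod k v 0 = (\<lambda>xs. if xs = [] then 0 else 1)"
| "cup_prod k v (Suc i) = cup (i * k) (cup_prod k v i) (v i)"

lemma cup_prod_Nil [simp]: "cup_prod k v i [] = 0"
  by (induction i) (auto simp: cup_def)

lemma indep_cup_prod: "(\<And>j. j < i \<Longrightarrow> indep b (v j)) \<Longrightarrow> indep b (cup_prod k v i)"
  by (induction i) (auto simp: indep_cup, simp add: indep_def)

lemma cup_prod_cocycle:
  assumes "\<And>j xs. j < i \<Longrightarrow> xs \<in> small_tuples e X (Suc k) \<Longrightarrow> cobd (v j) xs = 0"
    and "xs \<in> small_tuples e X (Suc (i * k))"
  shows "cobd (cup_prod k v i) xs = 0"
  using assms
proof (induction i arbitrary: xs)
  case 0
  then obtain x y where "xs = [x, y]"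
    by (auto simp: small_tuples_def length_Suc_conv)
  then show ?case by simp
next
  case (Suc i)
  have len: "length xs = i * k + k + 2" using Suc.prems(2) by (simp add: small_tuples_def)
  have "take (Suc (Suc (i * k))) xs \<in> small_tuples e X (Suc (i * k))"
    by (rule small_tuples_take[OF Suc.prems(2)]) simp
  then have 1: "cobd (cup_prod k v i) (take (Suc (Suc (i * k))) xs) = 0"
    by (intro Suc.IH Suc.prems(1)) auto
  have "drop (i * k) xs \<in> small_tuples e X (Suc k)"
    by (rule small_tuples_drop) (use Suc.prems(2) in \<open>simp add: add.commute\<close>)
  then have 2: "cobd (v i) (drop (i * k) xs) = 0"
    by (intro Suc.prems(1)) auto
  have "cobd (cup_prod k v (Suc i)) xs =
      cup (Suc (i * k)) (cobd (cup_prod k v i)) (v i) xs + (-1) ^ (i * k) * cup (i * k) (cup_prod k v i) (cobd (v i)) xs"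
    unfolding cup_prod.simps by (rule cobd_cup) (use len in simp)
  also have "\<dots> = 0" by (simp add: cup_def 1 2)
  finally show ?case .
qed

text \<open>Factor \<open>i\<close> is evaluated on a block of k + 1 consecutive points of the
  tuple.\<close>

lemma cup_prod_vanish:
  assumes "i < m" "length xs = Suc (m * k)"
    and "\<And>ys. set ys \<subseteq> set xs \<Longrightarrow> length ys = Suc k \<Longrightarrow> v i ys = 0"
  shows "cup_prod k v m xs = 0"
  using assms
proof (induction m arbitrary: xs)
  case (Suc m)
  show ?case
  proof (cases "i = m")
    case True
    have "v i (drop (m * k) xs) = 0"
      by (rule Suc.prems(3)) (use Suc.prems(2) in \<open>auto dest: in_set_dropD\<close>)
    then show ?thesis by (simp add: cup_def True)
  next
    case False
    have "cup_prod k v m (take (Suc (m * k)) xs) = 0"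
    proof (rule Suc.IH)
      show "v i ys = 0" if "set ys \<subseteq> set (take (Suc (m * k)) xs)" "length ys = Suc k" for ys
        by (rule Suc.prems(3)[OF order_trans[OF that(1) set_take_subset] that(2)])
    qed (use False Suc.prems in auto)
    then show ?thesis by (simp add: cup_def)
  qed
qed simp

text \<open>The cup length argument. Each \<open>v i\<close> is cohomologous to some
  \<open>v' i\<close> that vanishes on the small tuples inside \<open>A i\<close>. Every small tuple
  of full length lies in some \<open>A i\<close>, so the product of the \<open>v' i\<close> is zero,
  and the product of the \<open>v i\<close> differs from it by a coboundary.\<close>

proposition cycle_cup_prod_eq_0:
  assumes L: "is_cycle e X (m * k) L" and k: "k > 0"
    and cocycle: "\<And>i xs. i < m \<Longrightarrow> xs \<in> small_tuples e X (Suc k) \<Longrightarrow> cobd (v i) xs = 0"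
    and prim: "\<And>i xs. i < m \<Longrightarrow> xs \<in> small_tuples e X k \<Longrightarrow> set xs \<subseteq> A i \<Longrightarrow> v i xs = cobd (al i) xs"
    and cover: "\<And>xs. xs \<in> small_tuples e X (m * k) \<Longrightarrow> \<exists>i<m. set xs \<subseteq> A i"
    and al: "\<And>i. al i [] = 0" and v: "\<And>i. i < m \<Longrightarrow> v i [] = 0"
  shows "L (cup_prod k v m) = 0"
proof -
  \<comment> \<open>Extension by zero. The faces of a tuple inside \<open>A i\<close> are inside
    \<open>A i\<close> too, so the coboundary there does not change.\<close>
  define al' where "al' i xs = (if set xs \<subseteq> A i then al i xs else 0)" for i xs
  define v' where "v' i xs = v i xs - cobd (al' i) xs" for i xs
  have v'0: "v' i xs = 0" if "i < m" "xs \<in> small_tuples e X k" "set xs \<subseteq> A i" for i xs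
  proof -
    have "cobd (al' i) xs = cobd (al i) xs"
      by (rule cobd_cong) (use that in \<open>auto simp: al'_def\<close>)
    then show ?thesis using prim[OF that] by (simp add: v'_def)
  qed
  have v'_cocycle: "cobd (v' i) xs = 0" if "i < m" "xs \<in> small_tuples e X (Suc k)" for i xs
    using cocycle[OF that] unfolding v'_def[abs_def] by (simp add: cobd_diff cobd_cobd)
  let ?P = "cup_prod k v" and ?P' = "cup_prod k v'"
  have "\<exists>be. be [] = 0 \<and> (\<forall>xs\<in>small_tuples e X (j * k). ?P j xs = ?P' j xs + cobd be xs) \<and>
          (j = 0 \<longrightarrow> be = (\<lambda>_. 0))" if "j \<le> m" for j
    using that
  proof (induction j)
    case 0
    show ?case by (rule exI[of _ "\<lambda>_. 0"]) (simp add: cobd_0)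
  next
    case (Suc j)
    then obtain be where be: "be [] = 0" "j = 0 \<longrightarrow> be = (\<lambda>_. 0)"
      and P: "\<And>xs. xs \<in> small_tuples e X (j * k) \<Longrightarrow> ?P j xs = ?P' j xs + cobd be xs"
      by auto
    \<comment> \<open>Write P, P' for the two partial products. From P = P' + \<open>cobd be\<close>
      and v = v' + \<open>cobd (al' j)\<close> one gets P v - P' v' = P' \<open>cobd (al' j)\<close>
      + \<open>cobd be\<close> v, and \<open>ga\<close> is a primitive of this. For j = 0 the degree
      \<open>j * k - 1\<close> is truncated to 0; the clause on j = 0 in the claim makes that term
      vanish.\<close>
    define ga where "ga xs = (-1) ^ (j * k) * cup (j * k) (?P' j) (al' j) xs + cup (j * k - 1) be (v j) xs" for xs
    have "?P (Suc j) xs = ?P' (Suc j) xs + cobd ga xs" if xs: "xs \<in> small_tuples e X (Suc j * k)" for xs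
    proof -
      have len: "length xs = Suc (j * k + k)" using xs by (simp add: small_tuples_def)
      have "take (Suc (j * k)) xs \<in> small_tuples e X (j * k)"
        by (rule small_tuples_take[OF xs]) simp
      note P1 = P[OF this]
      have "cobd (cup (j * k) (?P' j) (al' j)) xs =
          cup (Suc (j * k)) (cobd (?P' j)) (al' j) xs + (-1) ^ (j * k) * cup (j * k) (?P' j) (cobd (al' j)) xs"
        by (rule cobd_cup) (use len k in simp)
      moreover have "cobd (?P' j) (take (Suc (Suc (j * k))) xs) = 0"
      proof (rule cup_prod_cocycle)
        show "take (Suc (Suc (j * k))) xs \<in> small_tuples e X (Suc (j * k))"
          by (rule small_tuples_take[OF xs]) (use k in simp)
      qed (use v'_cocycle Suc.prems in auto)
      ultimately have 1: "cobd (cup (j * k) (?P' j) (al' j)) xs =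
          (-1) ^ (j * k) * (?P' j (take (Suc (j * k)) xs) * cobd (al' j) (drop (j * k) xs))"
        by (simp add: cup_def)
      have 2: "cobd (cup (j * k - 1) be (v j)) xs = cobd be (take (Suc (j * k)) xs) * v j (drop (j * k) xs)"
      proof (cases "j = 0")
        case True
        then show ?thesis using be by (simp add: cup_def[abs_def] cobd_0)
      next
        case False
        then obtain q where q: "j * k = Suc q" using k by (cases "j * k") auto
        have "cobd (cup q be (v j)) xs = cup (Suc q) (cobd be) (v j) xs + (-1) ^ q * cup q be (cobd (v j)) xs"
          by (rule cobd_cup) (use len q in simp)
        moreover have "cobd (v j) (drop q xs) = 0"
          by (intro cocycle small_tuples_drop) (use xs Suc.prems q in \<open>auto simp: add.commute\<close>)
        ultimately show ?thesis by (simp add: cup_def q)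
      qed
      have "cobd ga xs = ?P' j (take (Suc (j * k)) xs) * cobd (al' j) (drop (j * k) xs)
          + cobd be (take (Suc (j * k)) xs) * v j (drop (j * k) xs)"
        unfolding ga_def[abs_def] cobd_add cobd_scale 1 2 by simp
      moreover have "?P (Suc j) xs = ?P j (take (Suc (j * k)) xs) * v j (drop (j * k) xs)"
        "?P' (Suc j) xs = ?P' j (take (Suc (j * k)) xs) * v' j (drop (j * k) xs)"
        by (simp_all add: cup_def)
      ultimately show ?thesis
        unfolding P1 v'_def by (simp add: algebra_simps)
    qed
    moreover have "ga [] = 0" by (simp add: ga_def cup_def be)
    ultimately show ?case by (intro exI[of _ ga]) simp
  qed
  from this[OF order_refl] obtain be where be: "be [] = 0"
    and P: "\<forall>xs\<in>small_tuples e X (m * k). ?P m xs = ?P' m xs + cobd be xs"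
    by (elim exE conjE) (rule that)
  have P'0: "?P' m xs = 0" if xs: "xs \<in> small_tuples e X (m * k)" for xs
  proof -
    obtain i where i: "i < m" "set xs \<subseteq> A i" using cover[OF xs] by blast
    show ?thesis
    proof (rule cup_prod_vanish[OF i(1)])
      fix ys assume "set ys \<subseteq> set xs" "length ys = Suc k"
      then show "v' i ys = 0"
        using i small_tuples_sub[OF xs] by (intro v'0) auto
    qed (use xs in \<open>simp add: small_tuples_def\<close>)
  qed
  have "L (?P m) = L (cobd be)"
  proof (rule is_cycle_cong[OF L])
    fix xs assume "xs \<in> small_tuples e X (m * k)"
    then show "?P m xs = cobd be xs" using bspec[OF P] P'0 by simp
  qed
  also have "\<dots> = 0" using L be by (rule is_cycle_cobd)
  finally show ?thesis .
qed

section \<open>Cycles that detect the products\<close>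

lemma point_is_cycle: "x \<in> X \<Longrightarrow> 0 \<le> e \<Longrightarrow> is_cycle e X 0 (\<lambda>f. f [x])"
  by (auto simp: is_cycle_def small_tuples_def near_refl)

lemma conf_nonempty: "(\<lambda>i\<in>{1..n}. axis_point 0 1) \<in> conf n k"
  by (auto simp: conf_def axis_point_Sph)

lemma phi_cocycle_conf:
  assumes "xs \<in> small_tuples e (conf n k) (Suc k)" "b \<in> {1..n}" "4 * (real k + 1) * e\<^sup>2 < 1"
  shows "cobd (on_coord b (phi k)) xs = 0"
  using assms(2)
  by (intro phi_cocycle_on_coord[OF small_tuples_mono[OF assms(1) order_refl] assms(3)])
    (auto simp: slice_def conf_def)

lemma diff_class_cocycle:
  assumes "xs \<in> small_tuples e (conf n k) (Suc k)" "b \<in> {1..n}" "4 * (real k + 1) * e\<^sup>2 < 1"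
  shows "cobd (diff_class k b) xs = 0"
  using phi_cocycle_conf[OF assms(1) _ assms(3), of b] phi_cocycle_conf[OF assms(1) _ assms(3), of 1] assms(2)
  unfolding diff_class_def[abs_def] cobd_diff by simp

lemma small_square_mono:
  assumes "4 * (real k + 1) * E\<^sup>2 < 1" "0 \<le> e" "e \<le> E"
  shows "4 * (real k + 1) * e\<^sup>2 < 1"
proof -
  have "4 * (real k + 1) * e\<^sup>2 \<le> 4 * (real k + 1) * E\<^sup>2"
    using assms by (intro mult_left_mono power_mono) auto
  with assms(1) show ?thesis by linarith
qed

text \<open>The earlier factors do not involve coordinate \<open>b\<close>. Hence the part of the
  new product that contains phi_1 is independent of \<open>b\<close> and is killed by the extended
  cycle, while the part that contains phi_b returns the old value up to sign.\<close>

lemma extend_nonzero_product: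
  assumes L: "is_cycle (e / 2) (conf n k) (m * k) L" "L (cup_prod k v m) \<noteq> 0"
    and e: "e > 0" "4 * (real k + 1) * e\<^sup>2 < 1" and b: "b \<in> {1..n}" "b \<noteq> 1"
    and v: "\<And>i. v i = diff_class k (a i)" "\<And>i. i < m \<Longrightarrow> a i \<in> {1..n} \<and> a i \<noteq> b" "a m = b"
  shows "\<exists>M. is_cycle e (conf n k) (Suc m * k) M \<and> M (cup_prod k v (Suc m)) \<noteq> 0"
proof -
  have e2: "0 \<le> e / 2" "e / 2 < e" using e by auto
  obtain M where M: "is_cycle e (conf n k) (m * k + k) M" "kills_indep b M"
    and eval: "\<forall>psi. indep b psi \<and> psi [] = 0 \<and> (\<forall>xs\<in>small_tuples e (conf n k) (Suc (m * k)). cobd psi xs = 0)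
       \<longrightarrow> M (cup (m * k) psi (on_coord b (phi k))) = (-1) ^ (k * Suc (m * k)) * L psi \<and>
           M (cup k (on_coord b (phi k)) psi) = (-1) ^ k * L psi"
    by (rule extend_cycle[OF L(1) e2 e(2) b(1)])
  let ?P = "cup_prod k v m"
  have ind1: "indep b (on_coord 1 (phi k))" by (rule indep_on_coord) (use b in auto)
  have "indep b (v i)" if "i < m" for i
    using v(2)[OF that] ind1 unfolding v(1) diff_class_def[abs_def]
    by (auto intro!: indep_diff intro: indep_on_coord)
  then have ind: "indep b ?P" by (rule indep_cup_prod)
  have "cobd ?P xs = 0" if "xs \<in> small_tuples e (conf n k) (Suc (m * k))" for xs
  proof (rule cup_prod_cocycle[OF _ that])
    fix i ys assume "i < m" "ys \<in> small_tuples e (conf n k) (Suc k)"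
    then show "cobd (v i) ys = 0"
      using v(2)[of i] diff_class_cocycle[OF _ _ e(2)] unfolding v(1) by auto
  qed
  then have "M (cup (m * k) ?P (on_coord b (phi k))) = (-1) ^ (k * Suc (m * k)) * L ?P"
    using eval[rule_format, of ?P] ind by simp
  moreover have "M (cup (m * k) ?P (on_coord 1 (phi k))) = 0"
    using M(2) indep_cup[OF ind ind1] by (simp add: kills_indep_def)
  moreover have "cup_prod k v (Suc m) =
      (\<lambda>xs. cup (m * k) ?P (on_coord b (phi k)) xs - cup (m * k) ?P (on_coord 1 (phi k)) xs)"
    by (simp add: v(1,3) cup_def diff_class_def fun_eq_iff algebra_simps)
  ultimately have "M (cup_prod k v (Suc m)) = (-1) ^ (k * Suc (m * k)) * L ?P"
    by (simp only: is_cycle_diff[OF M(1)])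
  then show ?thesis
    using M(1) L(2) by (auto simp: add.commute)
qed

proposition nonzero_product:
  assumes "4 * (real k + 1) * E\<^sup>2 < 1" "E > 0" "m < n"
  shows "\<exists>L. is_cycle E (conf n k) (m * k) L \<and> L (cup_prod k (\<lambda>i. diff_class k (i + 2)) m) \<noteq> 0"
  using assms
proof (induction m arbitrary: E)
  case 0
  show ?case
    by (rule exI[of _ "\<lambda>f. f [\<lambda>i\<in>{1..n}. axis_point 0 1]"])
      (use 0 point_is_cycle[OF conf_nonempty] in auto)
next
  case (Suc m)
  have "4 * (real k + 1) * (E / 2)\<^sup>2 < 1"
    by (rule small_square_mono[OF Suc.prems(1)]) (use Suc.prems in auto)
  then obtain L where "is_cycle (E / 2) (conf n k) (m * k) L" "L (cup_prod k (\<lambda>i. diff_class k (i + 2)) m) \<noteq> 0"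
    using Suc.IH[of "E / 2"] Suc.prems by auto
  then show ?case
    by (rule extend_nonzero_product[where b = "m + 2" and a = "\<lambda>i. i + 2"]) (use Suc.prems in auto)
qed

text \<open>Enumerates 2, 2, 3, 4, ..., so that only the first difference class is repeated.\<close>

definition doubled_index :: "nat \<Rightarrow> nat" where
  "doubled_index i = (if i = 0 then 2 else i + 1)"

text \<open>On a product of two sphere cycles, in the coordinates 1 and 2, the squares of phi_1 and
  phi_2 vanish and the expansion leaves minus the two mixed products, each of value 1 for even
  k.\<close>

lemma nonzero_square:
  assumes E: "4 * (real k + 1) * E\<^sup>2 < 1" "E > 0" and n: "n \<ge> 2" and k: "even k" "k > 0"
  shows "\<exists>L. is_cycle E (conf n k) (2 * k) L \<and> L (cup k (diff_class k 2) (diff_class k 2)) \<noteq> 0"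
proof -
  let ?x = "\<lambda>i\<in>{1..n}. axis_point 0 1"
  let ?f = "on_coord 1 (phi k)" and ?g = "on_coord 2 (phi k)"
  let ?u = "\<lambda>xs :: (nat \<Rightarrow> nat \<Rightarrow> real) list. if xs = [] then 0 else (1::int)"
  have Lx: "is_cycle 0 (conf n k) 0 (\<lambda>f. f [?x])"
    by (rule point_is_cycle[OF conf_nonempty]) simp
  have E2: "4 * (real k + 1) * (E / 2)\<^sup>2 < 1"
    by (rule small_square_mono[OF E(1)]) (use E in auto)
  have E0: "0 < E / 2" "0 \<le> E / 2" "E / 2 < E" and n12: "1 \<in> {1..n}" "2 \<in> {1..n}" using E n by auto
  obtain M where M: "is_cycle (E / 2) (conf n k) (0 + k) M"
    and "kills_indep 1 M"
    and eval: "\<forall>psi. indep 1 psi \<and> psi [] = 0 \<and> (\<forall>xs\<in>small_tuples (E / 2) (conf n k) (Suc 0). cobd psi xs = 0)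
       \<longrightarrow> M (cup 0 psi ?f) = (-1) ^ (k * Suc 0) * psi [?x] \<and>
           M (cup k ?f psi) = (-1) ^ k * psi [?x]"
    by (rule extend_cycle[OF Lx order_refl E0(1) E2 n12(1)])
  have "cobd ?u xs = 0" if "xs \<in> small_tuples (E / 2) (conf n k) (Suc 0)" for xs
  proof -
    obtain x y where "xs = [x, y]"
      using \<open>xs \<in> _\<close> by (auto simp: small_tuples_def length_Suc_conv)
    then show ?thesis by simp
  qed
  then have "M (cup 0 ?u ?f) = 1"
    using eval[rule_format, of ?u] k by (simp add: indep_def)
  moreover have "M (cup 0 ?u ?f) = M ?f"
    by (rule is_cycle_cong[OF M]) (auto simp: cup_def small_tuples_def)
  ultimately have Mf: "M ?f = 1" by simp
  obtain M2 where M2: "is_cycle E (conf n k) (0 + k + k) M2" "kills_indep 2 M2"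
    and eval2: "\<forall>psi. indep 2 psi \<and> psi [] = 0 \<and> (\<forall>xs\<in>small_tuples E (conf n k) (Suc (0 + k)). cobd psi xs = 0)
       \<longrightarrow> M2 (cup (0 + k) psi ?g) = (-1) ^ (k * Suc (0 + k)) * M psi \<and>
           M2 (cup k ?g psi) = (-1) ^ k * M psi"
    by (rule extend_cycle[OF M E0(2,3) E(1) n12(2)])
  have ind: "indep 2 ?f" "indep 1 ?g" by (auto intro: indep_on_coord)
  have fg: "M2 (cup k ?f ?g) = 1" "M2 (cup k ?g ?f) = 1"
    using eval2[rule_format, of ?f] ind(1) phi_cocycle_conf[OF _ n12(1) E(1)] k Mf
    by (simp_all add: on_coord_def)
  \<comment> \<open>\<open>M2\<close> is only known to kill what is independent of coordinate 2.
    Subtracting its image under the collapse of coordinate 1 also removes the square of phi_2;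
    products that contain phi_1 keep their value, as phi_1 is zero on collapsed tuples for k >
    0.\<close>
  define h where "h = map (set_coord 1 (axis_point 0 1))"
  define L where "L F = M2 F - M2 (\<lambda>xs. F (h xs))" for F
  have L: "is_cycle E (conf n k) (2 * k) L"
    unfolding L_def[abs_def] h_def
  proof (intro diff_is_cycle pushforward_is_cycle[where X = "conf n k"])
    show "is_cycle E (conf n k) (2 * k) M2" using M2 by (simp add: mult_2)
    then show "is_cycle E (conf n k) (2 * k) M2" .
    fix xs assume "xs \<in> small_tuples E (conf n k) (2 * k)"
    then have "map (set_coord 1 (axis_point 0 1)) xs \<in> small_tuples E (slice n k 1 k) (2 * k)"
      by (rule map_set_coord_small) (use n E axis_point_Sph in auto)
    then show "map (set_coord 1 (axis_point 0 1)) xs \<in> small_tuples E (conf n k) (2 * k)"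
      by (rule small_tuples_mono) (auto simp: slice_def)
  qed
  have fh: "?f (take i (h xs)) = 0" "?f (drop i (h xs)) = 0" for i xs
    unfolding h_def on_coord_def by (rule phi_constant[OF k(2)], auto simp: set_coord_def take_map drop_map)+
  have z: "M2 (\<lambda>xs. 0) = 0"
    by (rule is_cycle_zero[OF M2(1)]) simp
  have hz: "(\<lambda>xs. cup k ?f c (h xs)) = (\<lambda>_. 0)" "(\<lambda>xs. cup k c ?f (h xs)) = (\<lambda>_. 0)" for c
    unfolding cup_def fh by auto
  have "L (cup k ?f ?g) = 1" "L (cup k ?g ?f) = 1"
    unfolding L_def fg hz z by simp_all
  moreover have "L (cup k ?f ?f) = 0"
    using M2(2) indep_cup[OF ind(1) ind(1), of k]
    unfolding L_def hz z kills_indep_def by simp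
  moreover have "L (cup k ?g ?g) = 0"
  proof -
    have "cup k ?g ?g (h xs) = cup k ?g ?g xs" for xs
      unfolding h_def by (rule indep_map[OF indep_cup[OF ind(2) ind(2)]]) (simp add: set_coord_def)
    then show ?thesis by (simp add: L_def)
  qed
  moreover have "cup k (diff_class k 2) (diff_class k 2) = (\<lambda>xs. (cup k ?g ?g xs - cup k ?g ?f xs) - (cup k ?f ?g xs - cup k ?f ?f xs))"
    by (simp add: fun_eq_iff cup_def diff_class_def algebra_simps)
  ultimately have "L (cup k (diff_class k 2) (diff_class k 2)) = -2"
    by (simp only: is_cycle_diff[OF L])
  with L show ?thesis by (intro exI[of _ L]) simp
qed

proposition nonzero_product_even:
  assumes "4 * (real k + 1) * E\<^sup>2 < 1" "E > 0" "even k" "k > 0" "2 \<le> m" "m \<le> n"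
  shows "\<exists>L. is_cycle E (conf n k) (m * k) L \<and> L (cup_prod k (\<lambda>i. diff_class k (doubled_index i)) m) \<noteq> 0"
  using assms(5,1-4,6)
proof (induction m arbitrary: E rule: dec_induct)
  case base
  then obtain L where L: "is_cycle E (conf n k) (2 * k) L" "L (cup k (diff_class k 2) (diff_class k 2)) \<noteq> 0"
    using nonzero_square[of k E n] by auto
  have "L (cup_prod k (\<lambda>i. diff_class k (doubled_index i)) 2) = L (cup k (diff_class k 2) (diff_class k 2))"
    by (rule is_cycle_cong[OF L(1)])
      (auto simp: numeral_2_eq_2 cup_def doubled_index_def small_tuples_def)
  with L show ?case by auto
next
  case (step m)
  have "4 * (real k + 1) * (E / 2)\<^sup>2 < 1"
    by (rule small_square_mono[OF step.prems(1)]) (use step.prems in auto)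
  then obtain L where "is_cycle (E / 2) (conf n k) (m * k) L" "L (cup_prod k (\<lambda>i. diff_class k (doubled_index i)) m) \<noteq> 0"
    using step.IH[of "E / 2"] step.prems by auto
  then show ?case
    by (rule extend_nonzero_product[where b = "m + 1" and a = doubled_index])
      (use step in \<open>auto simp: doubled_index_def\<close>)
qed

section \<open>Topology of the configuration space and of the wedge\<close>

lemma nsphere_eq: "nsphere k = top_of_set (Sph k)"
proof -
  have "nsphere k = subtopology euclidean ({x. \<forall>i\<ge>Suc k. x i = 0} \<inter> {x. (\<Sum>i\<le>k. (x i)\<^sup>2) = 1})"
    by (simp add: nsphere_def Euclidean_space_def euclidean_product_topology subtopology_subtopology)
  also have "{x. \<forall>i\<ge>Suc k. x i = 0} \<inter> {x. (\<Sum>i\<le>k. (x i)\<^sup>2) = 1} = Sph k"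
    by (auto simp: Sph_def Suc_le_eq)
  finally show ?thesis .
qed

lemma continuous_on_coord [continuous_intros]:
  "continuous_on S f \<Longrightarrow> continuous_on S (\<lambda>x. f x i)"
  by (rule continuous_on_product_then_coordinatewise)

lemma compact_Sph: "compact (Sph k)"
proof -
  have cp: "compact (PiE UNIV (\<lambda>_::nat. {-1..1::real}))"
    using compactin_PiE[of "\<lambda>_. euclidean" UNIV "\<lambda>_::nat. {-1..1::real}"]
    by (simp add: euclidean_product_topology)
  have "closed {x :: nat \<Rightarrow> real. (\<Sum>i\<le>k. (x i)\<^sup>2) = 1}"
    by (intro closed_Collect_eq continuous_intros continuous_on_id)
  moreover have "{x :: nat \<Rightarrow> real. \<forall>i>k. x i = 0} = (\<Inter>i\<in>{k<..}. {x. x i = 0})"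
    by auto
  moreover have "closed (\<Inter>i\<in>{k<..}. {x :: nat \<Rightarrow> real. x i = 0})"
    by (intro closed_INT ballI closed_Collect_eq continuous_intros continuous_on_id)
  ultimately have "closed ({x :: nat \<Rightarrow> real. (\<Sum>i\<le>k. (x i)\<^sup>2) = 1} \<inter> {x. \<forall>i>k. x i = 0})"
    by (simp add: closed_Int)
  then have "closed (Sph k)" by (simp add: Sph_def Collect_conj_eq)
  then have "compact (PiE UNIV (\<lambda>_::nat. {-1..1::real}) \<inter> Sph k)"
    using cp by blast
  moreover have "Sph k \<subseteq> PiE UNIV (\<lambda>_::nat. {-1..1::real})"
    using Sph_abs_le_1 by (fastforce simp: abs_le_iff)
  ultimately show ?thesis by (simp add: Int_absorb1)
qed

text \<open>Places the configuration space inside the metric space of all functions, where Lebesgue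
  numbers and uniform continuity are available. Coordinates outside \<open>{1..n}\<close> are
  constantly \<open>undefined\<close> and so cause no loss of continuity.\<close>

lemma product_nsphere_eq: "product_topology (\<lambda>_. nsphere k) {1..n} = top_of_set (conf n k)"
proof -
  let ?P = "product_topology (\<lambda>_. nsphere k) {1..n}"
  have top: "topspace ?P = conf n k"
    by (simp add: nsphere_eq conf_def)
  have "continuous_map ?P euclidean (\<lambda>x. x i)" for i
  proof (cases "i \<in> {1..n}")
    case True
    from continuous_map_product_coordinates[OF this, of "\<lambda>_. nsphere k"] show ?thesis by (simp add: nsphere_eq continuous_map_in_subtopology)
  next
    case False
    have "continuous_map ?P euclidean (\<lambda>x. undefined)" by simp
    moreover have "undefined = x i" if "x \<in> topspace ?P" for x
    proof -
      have "x \<in> PiE {1..n} (\<lambda>_. Sph k)" using that unfolding top conf_def .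
      from PiE_arb[OF this False] show ?thesis by (rule sym)
    qed
    ultimately show ?thesis
      by (rule continuous_map_eq)
  qed
  then have "continuous_map ?P (product_topology (\<lambda>_. euclidean) UNIV) id"
    by (simp add: continuous_map_componentwise_UNIV)
  then have 1: "continuous_map ?P (top_of_set (conf n k)) id"
    using top by (simp add: euclidean_product_topology continuous_map_in_subtopology)
  have 2: "continuous_map (top_of_set (conf n k)) ?P id"
    unfolding continuous_map_componentwise
  proof (intro conjI ballI)
    show "id ` topspace (top_of_set (conf n k)) \<subseteq> extensional {1..n}"
      by (auto simp: conf_def PiE_def)
    fix i assume "i \<in> {1..n}"
    then show "continuous_map (top_of_set (conf n k)) (nsphere k) (\<lambda>x. id x i)"
      by (auto simp: nsphere_eq continuous_map_in_subtopology conf_def intro!: continuous_intros continuous_on_id)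
  qed
  have "openin ?P U \<longleftrightarrow> openin (top_of_set (conf n k)) U" for U
  proof -
    have *: "{x \<in> conf n k. id x \<in> U} = U" if "U \<subseteq> conf n k" using that by auto
    show ?thesis
      using openin_continuous_map_preimage[OF 1, of U] openin_continuous_map_preimage[OF 2, of U]
        * openin_subset[of ?P U] openin_subset[of "top_of_set (conf n k)" U] top by auto
  qed
  then show ?thesis by (simp add: topology_eq)
qed

lemma compact_conf: "compact (conf n k)"
proof -
  have "compact_space (nsphere k)"
    using compact_Sph by (simp add: nsphere_eq compact_space_subtopology)
  then have "compact_space (product_topology (\<lambda>_. nsphere k) {1..n})"
    by (simp add: compact_space_product_topology)
  then show ?thesis
    unfolding product_nsphere_eq by (simp add: compact_space_def compactin_subtopology)
qed

section \<open>Metric estimates and continuity along the arms\<close>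

lemma near_imp_dist:
  assumes "r > 0"
  obtains e where "e > 0" "\<And>x y. near e x y \<Longrightarrow> dist x y < r"
proof -
  obtain N :: nat where N: "(1/2) ^ N < r / 8"
    using real_arch_pow_inv[of "r / 8" "1/2"] assms by auto
  \<comment> \<open>The metric bound for functions is used twice, for the coordinates of a sphere
    point and for the index of the sphere. It gives 4 e + 3 (1/2)^N, which is below r/4 +
    3r/8.\<close>
  define e where "e = r / 16"
  have bound: "dist f g \<le> 2 * c + (1/2) ^ N" if "\<And>i. dist (f i) (g i) \<le> c"
    for c and f g :: "nat \<Rightarrow> 'b :: metric_space"
  proof -
    have "Max {dist (f (from_nat i)) (g (from_nat i)) |i. i \<le> N} \<le> c"
      by (subst Max_le_iff) (use that in auto)
    then show ?thesis
      using dist_fun_le_dist_first_terms[of f g N] by linarith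
  qed
  show ?thesis
  proof (rule that)
    show "e > 0" using assms by (simp add: e_def)
    fix x y assume ne: "near e x y"
    have "dist (x i) (y i) \<le> 2 * e + (1/2) ^ N" for i
      by (rule bound) (use ne in \<open>auto simp: near_def close_def dist_real_def\<close>)
    then have "dist x y \<le> 2 * (2 * e + (1/2) ^ N) + (1/2) ^ N" by (rule bound)
    also have "\<dots> < r" using N assms by (simp add: e_def)
    finally show "dist x y < r" .
  qed
qed

lemma continuous_map_wedge_arm:
  assumes "b \<in> {1..n}"
  shows "continuous_map (top_of_set {0..1}) (interval_wedge n) (\<lambda>t. wedge_proj (b, t))"
proof -
  let ?S = "sum_topology (\<lambda>i. top_of_set {0..1::real}) {1..n}"
  have "continuous_map (top_of_set {0..1}) ?S (\<lambda>t. (b, t))"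
    by (rule continuous_map_component_injection[OF assms])
  moreover have "continuous_map ?S (interval_wedge n) wedge_proj"
    unfolding interval_wedge_def by (rule quotient_imp_continuous_map[OF quotient_map_quotient_topology])
  ultimately show ?thesis
    using continuous_map_compose[of _ ?S] by (fastforce simp: comp_def)
qed

text \<open>Half of the exponential law: t has a compact neighbourhood in the interval that the arm
  of \<open>s x\<close> maps into \<open>W\<close>, and mapping this compact set into
  \<open>W\<close> is an open condition in the compact-open topology.\<close>

lemma arm_jointly_continuous:
  assumes s: "continuous_map (top_of_set C) (map_space (interval_wedge n) (top_of_set S)) s"
    and b: "b \<in> {1..n}"
  shows "continuous_on (C \<times> {0..1}) (\<lambda>(x, t). s x (wedge_proj (b, t)))"
proof -
  let ?J = "interval_wedge n" and ?q = "\<lambda>t. wedge_proj (b, t)"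
  let ?g = "\<lambda>(x, t). s x (?q t)"
  note q = continuous_map_wedge_arm[OF b]
  have sx: "continuous_map ?J (top_of_set S) (s x)" if "x \<in> C" for x
    using s that by (auto simp: continuous_map_def cmaps_def Pi_iff)
  have path: "continuous_map (top_of_set {0..1}) (top_of_set S) (\<lambda>t. s x (?q t))" if "x \<in> C" for x
    using continuous_map_compose[OF q sx[OF that]] by (simp add: comp_def)
  have "continuous_map (prod_topology (top_of_set C) (top_of_set {0..1})) (top_of_set S) ?g"
    unfolding continuous_map_def
  proof (intro conjI allI impI)
    show "?g \<in> topspace (prod_topology (top_of_set C) (top_of_set {0..1})) \<rightarrow> topspace (top_of_set S)"
      using path by (fastforce simp: continuous_map_def)
    fix W assume W: "openin (top_of_set S) W"
    show "openin (prod_topology (top_of_set C) (top_of_set {0..1}))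
        {z \<in> topspace (prod_topology (top_of_set C) (top_of_set {0..1})). ?g z \<in> W}"
      unfolding openin_prod_topology_alt
    proof (intro allI impI)
      fix x t assume "(x, t) \<in> {z \<in> topspace (prod_topology (top_of_set C) (top_of_set {0..1::real})). ?g z \<in> W}"
      then have x: "x \<in> C" and t: "t \<in> {0..1}" and gW: "s x (?q t) \<in> W" by auto
      have "openin (top_of_set {0..1}) {t \<in> {0..1}. s x (?q t) \<in> W}"
        using openin_continuous_map_preimage[OF path[OF x] W] by simp
      then obtain e where e: "e > 0" "\<And>t'. t' \<in> {0..1} \<Longrightarrow> dist t' t < e \<Longrightarrow> s x (?q t') \<in> W"
        using t gW unfolding openin_euclidean_subtopology_iff by blast
      define I where "I = cball t (e / 2) \<inter> {0..1}"
      have "compactin (top_of_set {0..1}) I"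
        by (auto simp: compactin_subtopology I_def compact_Int_closed)
      then have K: "compactin ?J (?q ` I)" by (rule image_compactin[OF _ q])
      let ?B = "{f \<in> cmaps ?J (top_of_set S). f ` (?q ` I) \<subseteq> W}"
      have "openin (map_space ?J (top_of_set S)) ?B"
        unfolding map_space_def by (rule topology_generated_by_Basis) (use K W in blast)
      from openin_continuous_map_preimage[OF s this]
      have B: "openin (top_of_set C) {y \<in> C. s y \<in> ?B}" by simp
      have cm: "s y \<in> cmaps ?J (top_of_set S)" if "y \<in> C" for y
        using s that by (auto simp: continuous_map_def)
      have "x \<in> {y \<in> C. s y \<in> ?B}"
        using e x cm by (auto simp: I_def dist_commute)
      moreover have "openin (top_of_set {0..1}) (ball t (e / 2) \<inter> {0..1})"
        by (simp add: openin_open_Int Int_commute)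
      moreover have "t \<in> ball t (e / 2) \<inter> {0..1}" using t e by simp
      moreover have "{y \<in> C. s y \<in> ?B} \<times> (ball t (e / 2) \<inter> {0..1})
          \<subseteq> {z \<in> topspace (prod_topology (top_of_set C) (top_of_set {0..1})). ?g z \<in> W}"
        by (auto simp: I_def image_subset_iff)
      ultimately show "\<exists>U V. openin (top_of_set C) U \<and> openin (top_of_set {0..1}) V \<and> x \<in> U \<and> t \<in> V \<and>
          U \<times> V \<subseteq> {z \<in> topspace (prod_topology (top_of_set C) (top_of_set {0..1})). ?g z \<in> W}"
        using B by blast
    qed
  qed
  then show ?thesis
    by (simp add: continuous_map_in_subtopology)
qed

section \<open>Sections give primitives of the difference classes\<close>

lemma arm_uniform:
  assumes s: "continuous_map (top_of_set C) (map_space (interval_wedge n) (top_of_set (Sph k))) s"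
    and b: "b \<in> {1..n}" and A: "compact A" "A \<subseteq> C" and r: "r > 0"
  obtains d where "d > 0"
    "\<And>x y t u. \<lbrakk>x \<in> A; y \<in> A; t \<in> {0..1}; u \<in> {0..1}; dist x y < d; \<bar>t - u\<bar> < d\<rbrakk>
       \<Longrightarrow> close r (s x (wedge_proj (b, t))) (s y (wedge_proj (b, u)))"
proof -
  let ?g = "\<lambda>z. s (fst z) (wedge_proj (b, snd z))"
  have cont: "continuous_on (A \<times> {0..1}) ?g"
    using arm_jointly_continuous[OF s b] continuous_on_subset[of "C \<times> {0..1}" _ "A \<times> {0..1}"] A(2)
    by (auto simp: case_prod_unfold)
  have "\<exists>d>0. \<forall>z\<in>A \<times> {0..1}. \<forall>w\<in>A \<times> {0..1}. dist w z < d \<longrightarrow> dist (?g w i) (?g z i) < r" for i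
  proof -
    have "uniformly_continuous_on (A \<times> {0..1}) (\<lambda>z. ?g z i)"
      by (rule compact_uniformly_continuous[OF continuous_on_product_then_coordinatewise[OF cont]
            compact_Times[OF A(1) compact_Icc]])
    from this[unfolded uniformly_continuous_on_def, rule_format, OF r] show ?thesis .
  qed
  then have "\<exists>D. \<forall>i. D i > 0 \<and>
      (\<forall>z\<in>A \<times> {0..1}. \<forall>w\<in>A \<times> {0..1}. dist w z < D i \<longrightarrow> dist (?g w i) (?g z i) < r)"
    by (intro choice allI)
  then obtain D where D: "\<And>i. D i > 0"
    "\<And>i z w. z \<in> A \<times> {0..1} \<Longrightarrow> w \<in> A \<times> {0..1} \<Longrightarrow> dist w z < D i \<Longrightarrow> dist (?g w i) (?g z i) < r"
    by blast
  \<comment> \<open>Only the k + 1 coordinates that can be nonzero need a bound, so the minimum is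
    over a finite set. The distance in the product is at most the sum of the two distances, hence
    the half.\<close>
  define d where "d = Min (D ` {..k}) / 2"
  have "d > 0" using D(1) by (simp add: d_def)
  have img: "s x p \<in> Sph k" if "x \<in> C" "p \<in> topspace (interval_wedge n)" for x p
  proof -
    have "s x \<in> cmaps (interval_wedge n) (top_of_set (Sph k))"
      using s that(1) by (auto simp: continuous_map_def)
    then show ?thesis using that(2) by (auto simp: cmaps_def continuous_map_def)
  qed
  have arm: "wedge_proj (b, t) \<in> topspace (interval_wedge n)" if "t \<in> {0..1}" for t
    using continuous_map_wedge_arm[OF b] that by (auto simp: continuous_map_def)
  show ?thesis
  proof (rule that[OF \<open>d > 0\<close>])
    fix x y t u
    assume *: "x \<in> A" "y \<in> A" "t \<in> {0..1}" "u \<in> {0..1}" "dist x y < d" "\<bar>t - u\<bar> < d"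
    have "dist (x, t) (y, u) \<le> dist x y + dist t u"
      unfolding dist_Pair_Pair by (rule sqrt_sum_squares_le_sum) auto
    also have "\<dots> < d + d" using * by (intro add_strict_mono) (auto simp: dist_real_def)
    also have "d + d = Min (D ` {..k})" by (simp only: d_def field_sum_of_halves)
    finally have lt: "dist (x, t) (y, u) < Min (D ` {..k})" .
    show "close r (s x (wedge_proj (b, t))) (s y (wedge_proj (b, u)))"
      unfolding close_def
    proof
      fix i
      show "\<bar>s x (wedge_proj (b, t)) i - s y (wedge_proj (b, u)) i\<bar> \<le> r"
      proof (cases "i \<le> k")
        case True
        then have "Min (D ` {..k}) \<le> D i" by (intro Min_le) auto
        then have "dist (?g (x, t) i) (?g (y, u) i) < r"
          using * by (intro D(2) less_le_trans[OF lt]) auto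
        then show ?thesis by (simp add: dist_real_def)
      next
        case False
        then have "s x (wedge_proj (b, t)) i = 0" "s y (wedge_proj (b, u)) i = 0"
          using img[OF _ arm] * A(2) by (auto simp: Sph_def)
        then show ?thesis using r by simp
      qed
    qed
  qed
qed

lemma small_square_witness: "4 * (real k + 1) * (1 / (4 * (real k + 1)))\<^sup>2 < 1"
proof -
  have "c * (1 / c)\<^sup>2 < 1" if "c > 1" for c :: real
    using that by (simp add: power2_eq_square)
  then show ?thesis by simp
qed

text \<open>Walking along arm \<open>b\<close> of the section deforms x -> \<open>s x (0, 0)\<close>
  into the b-th projection. If the walk is sampled finely, its prisms consist of small tuples on the
  sphere, where \<open>phi k\<close> is a cocycle, and the homotopy formula yields the
  primitive.\<close>

lemma arm_primitive:
  assumes s: "continuous_map (top_of_set C) (map_space (interval_wedge n) (top_of_set (Sph k))) s"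
    and sec: "\<And>x. x \<in> C \<Longrightarrow> end_eval n (s x) = x"
    and b: "b \<in> {1..n}" and A: "compact A" "A \<subseteq> C"
  obtains e al where "e > 0" "al [] = 0"
    "\<And>xs. xs \<in> small_tuples e X k \<Longrightarrow> set xs \<subseteq> A \<Longrightarrow>
       on_coord b (phi k) xs - phi k (map (\<lambda>x. s x (0, 0)) xs) = cobd al xs"
proof -
  obtain r where r: "r > 0" "4 * (real k + 1) * r\<^sup>2 < 1"
    using that[of "1 / (4 * (real k + 1))"] small_square_witness by simp
  obtain d where d: "d > 0"
    and cl: "\<And>x y t u. \<lbrakk>x \<in> A; y \<in> A; t \<in> {0..1}; u \<in> {0..1}; dist x y < d; \<bar>t - u\<bar> < d\<rbrakk>
       \<Longrightarrow> close r (s x (wedge_proj (b, t))) (s y (wedge_proj (b, u)))"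
    using arm_uniform[OF s b A r(1)] by blast
  obtain e where e: "e > 0" "\<And>x y. near e x y \<Longrightarrow> dist x y < d"
    using near_imp_dist[OF d] by blast
  obtain N :: nat where N: "N > 0" "1 / N < d"
    using d by (metis nat_approx_posE zero_less_Suc)
  define h where "h j x = s x (wedge_proj (b, real j / N))" for j x
  have img: "h j x \<in> Sph k" if "x \<in> C" "j \<le> N" for x j
  proof -
    have "s x \<in> cmaps (interval_wedge n) (top_of_set (Sph k))"
      using s that(1) by (auto simp: continuous_map_def)
    moreover have "wedge_proj (b, real j / N) \<in> topspace (interval_wedge n)"
      using continuous_map_wedge_arm[OF b] that(2) N by (auto simp: continuous_map_def divide_le_eq)
    ultimately show ?thesis by (auto simp: cmaps_def continuous_map_def h_def)
  qed
  show ?thesis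
  proof (rule that[OF e(1), of "hprism h N (phi k)"])
    fix xs assume xs: "xs \<in> small_tuples e X k" "set xs \<subseteq> A"
    have ne: "dist x y < d" if "x \<in> set xs" "y \<in> set xs" for x y
      using xs that e(2) by (auto simp: small_tuples_def)
    have "hprism h N (cobd (phi k)) xs = hprism h N (\<lambda>_. 0) xs"
    proof (rule hprism_cong)
      fix i ys assume i: "i < N" and ys: "set ys \<subseteq> h i ` set xs \<union> h (Suc i) ` set xs" "length ys = Suc (length xs)"
      have mem: "\<exists>x l. x \<in> set xs \<and> (l = i \<or> l = Suc i) \<and> u = h l x" if "u \<in> set ys" for u
        using subsetD[OF ys(1) that] by blast
      show "cobd (phi k) ys = 0"
      proof (rule phi_cocycle[OF _ _ _ r(2)])
        show "length ys = k + 2" using ys xs by (simp add: small_tuples_def)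
        show "set ys \<subseteq> Sph k"
        proof
          fix u assume "u \<in> set ys"
          then obtain x l where "x \<in> set xs" "l = i \<or> l = Suc i" "u = h l x" using mem by blast
          then show "u \<in> Sph k" using img[of x l] xs(2) A(2) i by auto
        qed
        fix u v assume "u \<in> set ys" "v \<in> set ys"
        then obtain x l y l' where x: "x \<in> set xs" "l = i \<or> l = Suc i" "u = h l x"
          and y: "y \<in> set xs" "l' = i \<or> l' = Suc i" "v = h l' y" using mem by meson
        have "\<bar>real l / N - real l' / N\<bar> \<le> 1 / N"
          using x(2) y(2) N(1) by (auto simp: field_simps abs_if simp flip: diff_divide_distrib)
        then have dl: "\<bar>real l / N - real l' / N\<bar> < d" using N(2) by linarith
        have "real l / N \<in> {0..1}" "real l' / N \<in> {0..1}"
          using i x(2) y(2) N(1) by (auto simp: divide_le_eq)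
        then show "close r u v"
          unfolding x(3) y(3) h_def
          by (rule cl[rotated 2]) (use x(1) y(1) xs(2) ne dl in auto)
      qed
    qed
    also have "\<dots> = 0"
      using hprism_linear[of h N 0 "\<lambda>_. 0" 0 "\<lambda>_. 0" xs] by simp
    finally have "cobd (hprism h N (phi k)) xs = phi k (map (h N) xs) - phi k (map (h 0) xs)"
      using hprism_homotopy[of h N "phi k" xs] by simp
    moreover have "h N x = x b" if "x \<in> set xs" for x
    proof -
      have "end_eval n (s x) b = x b" using sec that xs(2) A(2) by auto
      then show ?thesis using b N(1) by (simp add: end_eval_def h_def)
    qed
    then have "map (h N) xs = map (\<lambda>x. x b) xs" by simp
    moreover have "h 0 = (\<lambda>x. s x (0, 0))" by (auto simp: h_def wedge_proj_def)
    ultimately show "on_coord b (phi k) xs - phi k (map (\<lambda>x. s x (0, 0)) xs) = cobd (hprism h N (phi k)) xs"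
      by (simp add: on_coord_def)
  qed simp
qed

text \<open>The term with the common starting point \<open>s x (0, 0)\<close> cancels between arm
  \<open>b\<close> and arm 1.\<close>

lemma diff_class_primitive:
  assumes s: "continuous_map (top_of_set C) (map_space (interval_wedge n) (top_of_set (Sph k))) s"
    and sec: "\<And>x. x \<in> C \<Longrightarrow> end_eval n (s x) = x"
    and b: "b \<in> {1..n}" and A: "compact A" "A \<subseteq> C"
  obtains e al where "e > 0" "al [] = 0"
    "\<And>xs. xs \<in> small_tuples e X k \<Longrightarrow> set xs \<subseteq> A \<Longrightarrow> diff_class k b xs = cobd al xs"
proof -
  have one: "1 \<in> {1..n}" using b by auto
  obtain e al where 1: "e > 0" "al [] = 0"
    "\<And>xs. xs \<in> small_tuples e X k \<Longrightarrow> set xs \<subseteq> A \<Longrightarrow>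
       on_coord b (phi k) xs - phi k (map (\<lambda>x. s x (0, 0)) xs) = cobd al xs"
    using arm_primitive[OF s sec b A] by metis
  obtain e' al' where 2: "e' > 0" "al' [] = 0"
    "\<And>xs. xs \<in> small_tuples e' X k \<Longrightarrow> set xs \<subseteq> A \<Longrightarrow>
       on_coord 1 (phi k) xs - phi k (map (\<lambda>x. s x (0, 0)) xs) = cobd al' xs"
    using arm_primitive[OF s sec one A] by metis
  show ?thesis
  proof (rule that[of "min e e'" "\<lambda>xs. al xs - al' xs"])
    fix xs assume xs: "xs \<in> small_tuples (min e e') X k" "set xs \<subseteq> A"
    have "xs \<in> small_tuples e X k" "xs \<in> small_tuples e' X k"
      by (rule small_tuples_mono[OF xs(1)]; simp)+
    from 1(3)[OF this(1) xs(2)] 2(3)[OF this(2) xs(2)]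
    show "diff_class k b xs = cobd (\<lambda>xs. al xs - al' xs) xs"
      by (simp add: cobd_diff diff_class_def)
  qed (use 1 2 in auto)
qed

proposition no_short_cover:
  assumes nonzero: "\<And>E. E > 0 \<Longrightarrow> 4 * (real k + 1) * E\<^sup>2 < 1 \<Longrightarrow>
      \<exists>L. is_cycle E (conf n k) (m * k) L \<and> L (cup_prod k (\<lambda>i. diff_class k (a i)) m) \<noteq> 0"
    and a: "\<And>i. i < m \<Longrightarrow> a i \<in> {1..n}" and k: "k > 0"
    and op: "\<And>i. i < m \<Longrightarrow> openin (top_of_set (conf n k)) (C i)"
    and cov: "conf n k \<subseteq> (\<Union>i<m. C i)"
    and s: "\<And>i. i < m \<Longrightarrow> continuous_map (top_of_set (C i)) (map_space (interval_wedge n) (top_of_set (Sph k))) (s i)"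
    and sec: "\<And>i x. i < m \<Longrightarrow> x \<in> C i \<Longrightarrow> end_eval n (s i x) = x"
  shows False
proof -
  let ?X = "conf n k"
  have "\<exists>T. open T \<and> C i = ?X \<inter> T" if "i < m" for i
    using op[OF that] by (auto simp: openin_open)
  then obtain T where T: "\<And>i. i < m \<Longrightarrow> open (T i) \<and> C i = ?X \<inter> T i" by metis
  have "?X \<subseteq> \<Union>(T ` {..<m})" using cov T by fastforce
  then obtain r where r: "r > 0" "\<And>x. x \<in> ?X \<Longrightarrow> \<exists>G\<in>T ` {..<m}. ball x r \<subseteq> G"
    by (rule Heine_Borel_lemma[OF compact_conf]) (use T in auto)
  \<comment> \<open>A compact shrinking of the cover by half its Lebesgue number. If the
    \<open>r\<close>-ball about one point of a tuple of diameter below r/2 lies in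
    \<open>T i\<close>, then the whole tuple keeps the distance r/2 from the complement of
    \<open>C i\<close>.\<close>
  define A where "A i = ?X \<inter> (\<Inter>y\<in>?X - C i. {x. r / 2 \<le> dist x y})" for i
  have A: "compact (A i)" "A i \<subseteq> C i" for i
  proof -
    have "closed (\<Inter>y\<in>?X - C i. {x. r / 2 \<le> dist x y})"
      by (intro closed_INT ballI closed_Collect_le continuous_intros continuous_on_id)
    then show "compact (A i)" unfolding A_def by (intro compact_Int_closed compact_conf)
    show "A i \<subseteq> C i"
    proof
      fix x assume x: "x \<in> A i"
      show "x \<in> C i"
      proof (rule ccontr)
        assume "x \<notin> C i"
        with x have "r / 2 \<le> dist x x" unfolding A_def by blast
        with r(1) show False by simp
      qed
    qed
  qed
  have "\<exists>e al. e > 0 \<and> al [] = 0 \<and>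
      (\<forall>xs\<in>small_tuples e ?X k. set xs \<subseteq> A i \<longrightarrow> diff_class k (a i) xs = cobd al xs)" if "i < m" for i
    using diff_class_primitive[OF s[OF that] sec[OF that] a[OF that] A, of ?X] by metis
  then obtain e al where e: "\<And>i. i < m \<Longrightarrow> e i > 0" and al: "\<And>i. i < m \<Longrightarrow> al i [] = 0"
    and prim: "\<And>i xs. i < m \<Longrightarrow> xs \<in> small_tuples (e i) ?X k \<Longrightarrow> set xs \<subseteq> A i \<Longrightarrow> diff_class k (a i) xs = cobd (al i) xs"
    by metis
  obtain e1 where e1: "e1 > 0" "\<And>x y. near e1 x y \<Longrightarrow> dist x y < r / 2"
    using near_imp_dist[of "r / 2"] r(1) by auto
  define E where "E = Min (insert e1 (insert (1 / (4 * (real k + 1))) (e ` {..<m})))"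
  have "E > 0"
    unfolding E_def using e e1(1) by (subst Min_gr_iff) auto
  moreover have "E \<le> e1" "\<And>i. i < m \<Longrightarrow> E \<le> e i" "E \<le> 1 / (4 * (real k + 1))"
    unfolding E_def by (rule Min_le; simp)+
  ultimately have E: "E > 0" "E \<le> e1" "\<And>i. i < m \<Longrightarrow> E \<le> e i" "E \<le> 1 / (4 * (real k + 1))"
    by blast+
  have E4: "4 * (real k + 1) * E\<^sup>2 < 1"
    by (rule small_square_mono[OF small_square_witness]) (use E in auto)
  obtain L where L: "is_cycle E ?X (m * k) L" "L (cup_prod k (\<lambda>i. diff_class k (a i)) m) \<noteq> 0"
    using nonzero[OF E(1) E4] by blast
  have "L (cup_prod k (\<lambda>i. diff_class k (a i)) m) = 0"
  proof (rule cycle_cup_prod_eq_0[OF L(1) k, where A = A and al = "\<lambda>i. if i < m then al i else (\<lambda>_. 0)"])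
    fix i xs assume "i < m" "xs \<in> small_tuples E ?X (Suc k)"
    then show "cobd (diff_class k (a i)) xs = 0" using diff_class_cocycle[OF _ a E4] by blast
  next
    fix i xs assume i: "i < m" and xs: "xs \<in> small_tuples E ?X k" "set xs \<subseteq> A i"
    have "xs \<in> small_tuples (e i) ?X k"
      by (rule small_tuples_mono[OF xs(1) E(3)[OF i] order_refl])
    with i xs(2) show "diff_class k (a i) xs = cobd (if i < m then al i else (\<lambda>_. 0)) xs"
      using prim by simp
  next
    fix xs assume xs: "xs \<in> small_tuples E ?X (m * k)"
    then obtain x where x: "x \<in> set xs" "x \<in> ?X" by (cases xs) (auto simp: small_tuples_def)
    obtain i where i: "i < m" "ball x r \<subseteq> T i" using r(2)[OF x(2)] by auto
    have "y \<in> A i" if y: "y \<in> set xs" for y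
    proof -
      have "near e1 x y" using xs x y near_mono[OF _ E(2)] by (auto simp: small_tuples_def)
      then have xy: "dist x y < r / 2" by (rule e1(2))
      have "r / 2 \<le> dist y z" if z: "z \<in> ?X - C i" for z
      proof -
        have "z \<notin> ball x r" using z i T by blast
        then have "r \<le> dist x z" by simp
        then show ?thesis using xy dist_triangle[of x z y] by linarith
      qed
      then show "y \<in> A i" using xs y by (auto simp: A_def small_tuples_def)
    qed
    with i(1) show "\<exists>i<m. set xs \<subseteq> A i" by blast
  qed (auto simp: al diff_class_def on_coord_def)
  with L(2) show False by simp
qed

section \<open>Motions along broken lines on the sphere\<close>

lemma openin_tube:
  assumes g: "continuous_map (prod_topology X J) Y g" and K: "compactin J K" and W: "openin Y W"
  shows "openin X {x \<in> topspace X. \<forall>z\<in>K. g (x, z) \<in> W}"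
proof (subst openin_subopen, intro ballI)
  fix x assume x: "x \<in> {x \<in> topspace X. \<forall>z\<in>K. g (x, z) \<in> W}"
  let ?V = "{p \<in> topspace (prod_topology X J). g p \<in> W}"
  have "openin (prod_topology X J) ?V" by (rule openin_continuous_map_preimage[OF g W])
  moreover have "{x} \<times> K \<subseteq> ?V"
    using x compactin_subset_topspace[OF K] by auto
  ultimately obtain U V where UV: "openin X U" "x \<in> U" "K \<subseteq> V" "U \<times> V \<subseteq> ?V"
    using tube_lemma_right[of X J ?V K x] K x by auto
  have "U \<subseteq> {x \<in> topspace X. \<forall>z\<in>K. g (x, z) \<in> W}"
    using UV openin_subset[OF UV(1)] by blast
  with UV show "\<exists>T. openin X T \<and> x \<in> T \<and> T \<subseteq> {x \<in> topspace X. \<forall>z\<in>K. g (x, z) \<in> W}"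
    by blast
qed

text \<open>The other half of the exponential law, valid for every \<open>J\<close>: by the tube
  lemma over the compact set \<open>K\<close>, the preimage of a subbasic open set is open.\<close>

lemma continuous_map_curry:
  assumes g: "continuous_map (prod_topology X J) Y (\<lambda>(x, z). g x z)"
  shows "continuous_map X (map_space J Y) (\<lambda>x. restrict (g x) (topspace J))"
proof -
  have cm: "restrict (g x) (topspace J) \<in> cmaps J Y" if "x \<in> topspace X" for x
  proof -
    have "continuous_map J (prod_topology X J) (\<lambda>z. (x, z))"
      using that by (intro continuous_map_pairedI) auto
    from continuous_map_compose[OF this g] have "continuous_map J Y (g x)"
      by (simp add: comp_def)
    then have "continuous_map J Y (restrict (g x) (topspace J))"
      by (rule continuous_map_eq) simp
    then show ?thesis by (simp add: cmaps_def)
  qed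
  show ?thesis
    unfolding map_space_def
  proof (rule continuous_on_generated_topo)
    let ?h = "\<lambda>x. restrict (g x) (topspace J)"
    fix B assume "B \<in> {{f \<in> cmaps J Y. f ` K \<subseteq> U} | K U. compactin J K \<and> openin Y U}"
    then obtain K U where B: "B = {f \<in> cmaps J Y. f ` K \<subseteq> U}" "compactin J K" "openin Y U"
      by blast
    have K: "K \<subseteq> topspace J" using compactin_subset_topspace[OF B(2)] .
    have "?h -` B \<inter> topspace X = {x \<in> topspace X. \<forall>z\<in>K. (\<lambda>(x, z). g x z) (x, z) \<in> U}"
      unfolding B(1) using cm K by (auto simp: image_subset_iff subset_iff)
    then show "openin X (?h -` B \<inter> topspace X)"
      using openin_tube[OF g B(2,3)] by simp
  next
    have "cmaps J Y \<in> {{f \<in> cmaps J Y. f ` K \<subseteq> U} | K U. compactin J K \<and> openin Y U}"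
      by (intro CollectI exI[of _ "{}"]) auto
    then show "(\<lambda>x. restrict (g x) (topspace J)) ` topspace X
        \<subseteq> \<Union>{{f \<in> cmaps J Y. f ` K \<subseteq> U} | K U. compactin J K \<and> openin Y U}"
      using cm by blast
  qed
qed

text \<open>Realises the wedge as a union of unit segments on coordinate axes, so that a motion can
  be given by one polynomial formula for all arms.\<close>

definition wedge_coords :: "nat \<times> real \<Rightarrow> nat \<Rightarrow> real" where
  "wedge_coords z = axis_point (fst z) (snd z)"

definition arms :: "nat \<Rightarrow> (nat \<Rightarrow> real) set" where
  "arms n = (\<Union>b\<in>{1..n}. axis_point b ` {0..1})"

lemma continuous_on_axis_point: "continuous_on S (axis_point b)"
  unfolding axis_point_def
proof (rule continuous_on_coordinatewise_then_product)
  show "continuous_on S (\<lambda>x. if i = b then x else 0)" for i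
    by (cases "i = b") (simp_all add: continuous_on_id)
qed

lemma compact_arms: "compact (arms n)"
  unfolding arms_def by (intro compact_UN compact_continuous_image continuous_on_axis_point) auto

lemma wedge_coords_proj: "wedge_coords (wedge_proj (b, t)) = axis_point b t"
  by (auto simp: wedge_coords_def wedge_proj_def axis_point_def)

lemma topspace_interval_wedge:
  "topspace (interval_wedge n) = wedge_proj ` ({1..n} \<times> {0..1})"
  by (simp add: interval_wedge_def comp_def)

lemma continuous_map_wedge_coords: "continuous_map (interval_wedge n) (top_of_set (arms n)) wedge_coords"
proof -
  let ?S = "sum_topology (\<lambda>i. top_of_set {0..1::real}) {1..n}"
  have "continuous_map ?S euclidean (wedge_coords \<circ> wedge_proj)"
    unfolding continuous_map_def
  proof (intro conjI allI impI)
    fix U :: "(nat \<Rightarrow> real) set" assume U: "openin euclidean U"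
    have "{x. (b, x) \<in> {z \<in> topspace ?S. (wedge_coords \<circ> wedge_proj) z \<in> U}} = {0..1} \<inter> axis_point b -` U"
      if "b \<in> {1..n}" for b
      using that by (auto simp: wedge_coords_proj)
    moreover have "openin (top_of_set {0..1}) ({0..1} \<inter> axis_point b -` U)" for b
      by (rule continuous_openin_preimage_gen[OF continuous_on_axis_point]) (use U in simp)
    ultimately show "openin ?S {z \<in> topspace ?S. (wedge_coords \<circ> wedge_proj) z \<in> U}"
      unfolding openin_sum_topology by auto
  qed auto
  then have "continuous_map (interval_wedge n) euclidean wedge_coords"
    unfolding interval_wedge_def by (rule continuous_compose_quotient_map[OF quotient_map_quotient_topology])
  then show ?thesis
    by (auto simp: continuous_map_in_subtopology topspace_interval_wedge wedge_coords_proj arms_def)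
qed

text \<open>The weights \<open>w\<close> are the coordinates of a point of the wedge. The quadratic term bends the segment
  from \<open>x 1\<close> to \<open>x i\<close> away from the origin for the indices in \<open>I\<close>.\<close>

definition motion ::
  "nat \<Rightarrow> nat set \<Rightarrow> ((nat \<Rightarrow> real) \<Rightarrow> nat \<Rightarrow> real) \<Rightarrow> (nat \<Rightarrow> nat \<Rightarrow> real) \<Rightarrow> (nat \<Rightarrow> real) \<Rightarrow> nat \<Rightarrow> real" where
  "motion n I v x w q = x 1 q + (\<Sum>i=2..n. w i * (x i q - x 1 q) +
     (if i \<in> I then 4 * w i * (1 - w i) * v (x 1) q else 0))"

definition sq_norm :: "nat \<Rightarrow> (nat \<Rightarrow> real) \<Rightarrow> real" where
  "sq_norm k u = (\<Sum>q\<le>k. (u q)\<^sup>2)"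

text \<open>The configurations whose motion misses the origin on every arm and can therefore be
  normalised to the sphere.\<close>

definition motion_dom :: "nat \<Rightarrow> nat \<Rightarrow> nat set \<Rightarrow> ((nat \<Rightarrow> real) \<Rightarrow> nat \<Rightarrow> real) \<Rightarrow> (nat \<Rightarrow> nat \<Rightarrow> real) set" where
  "motion_dom n k I v = {x \<in> conf n k. \<forall>w\<in>arms n. sq_norm k (motion n I v x w) \<noteq> 0}"

lemma continuous_on_motion:
  assumes v: "\<And>q. continuous_on (Sph k) (\<lambda>u. v u q)" and n: "n \<ge> 1"
  shows "continuous_on (conf n k \<times> S) (\<lambda>p. motion n I v (fst p) (snd p) q)"
proof -
  have 1: "continuous_on (conf n k \<times> S) (\<lambda>p. fst p i)" for i
    by (rule continuous_on_product_then_coordinatewise[OF continuous_on_fst[OF continuous_on_id]])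
  have 2: "continuous_on (conf n k \<times> S) (\<lambda>p. fst p i q)" for i q
    by (rule continuous_on_product_then_coordinatewise[OF 1])
  have 3: "continuous_on (conf n k \<times> S) (\<lambda>p. snd p i)" for i
    by (rule continuous_on_product_then_coordinatewise[OF continuous_on_snd[OF continuous_on_id]])
  have 4: "continuous_on (conf n k \<times> S) (\<lambda>p. v (fst p 1) q)"
    by (rule continuous_on_compose2[OF v 1]) (use n in \<open>auto simp: conf_def\<close>)
  have 5: "continuous_on (conf n k \<times> S) (\<lambda>p. if i \<in> I then 4 * snd p i * (1 - snd p i) * v (fst p 1) q else 0)" for i
  proof (cases "i \<in> I")
    case True
    have "continuous_on (conf n k \<times> S) (\<lambda>p. 4 * snd p i * (1 - snd p i) * v (fst p 1) q)"
      by (rule continuous_on_mult[OF continuous_on_mult[OF continuous_on_mult[OF continuous_on_const 3]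
              continuous_on_diff[OF continuous_on_const 3]] 4])
    with True show ?thesis by simp
  qed simp
  show ?thesis
    unfolding motion_def
    by (rule continuous_on_add[OF 2 continuous_on_sum
          [OF continuous_on_add[OF continuous_on_mult[OF 3 continuous_on_diff[OF 2 2]] 5]]])
qed

lemma motion_arm:
  assumes "b \<in> {1..n}"
  shows "motion n I v x (axis_point b t) q =
    (if b = 1 then x 1 q else x 1 q + t * (x b q - x 1 q) + (if b \<in> I then 4 * t * (1 - t) * v (x 1) q else 0))"
proof -
  have "(\<Sum>i=2..n. axis_point b t i * (x i q - x 1 q) +
     (if i \<in> I then 4 * axis_point b t i * (1 - axis_point b t i) * v (x 1) q else 0)) =
     (\<Sum>i=2..n. if i = b then t * (x b q - x 1 q) + (if b \<in> I then 4 * t * (1 - t) * v (x 1) q else 0) else 0)"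
    by (intro sum.cong) (auto simp: axis_point_def)
  then show ?thesis
    using assms by (auto simp: motion_def)
qed

lemma openin_motion_dom:
  assumes "\<And>q. continuous_on (Sph k) (\<lambda>u. v u q)" "n \<ge> 1"
  shows "openin (top_of_set (conf n k)) (motion_dom n k I v)"
proof -
  have "continuous_on (conf n k \<times> arms n) (\<lambda>p. sq_norm k (motion n I v (fst p) (snd p)))"
    unfolding sq_norm_def by (intro continuous_on_sum continuous_on_power continuous_on_motion assms)
  then have g: "continuous_map (prod_topology (top_of_set (conf n k)) (top_of_set (arms n))) euclidean
      (\<lambda>p. sq_norm k (motion n I v (fst p) (snd p)))"
    by simp
  have "compactin (top_of_set (arms n)) (arms n)"
    by (simp add: compactin_subtopology compact_arms)
  from openin_tube[OF g this, of "- {0}"] show ?thesis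
    by (simp add: motion_dom_def open_Compl)
qed

lemma motion_section:
  assumes v: "\<And>q. continuous_on (Sph k) (\<lambda>u. v u q)" "\<And>u q. q > k \<Longrightarrow> v u q = 0" and n: "n \<ge> 1"
  shows "\<exists>s. continuous_map (top_of_set (motion_dom n k I v)) (map_space (interval_wedge n) (top_of_set (Sph k))) s
    \<and> (\<forall>x\<in>motion_dom n k I v. end_eval n (s x) = x)"
proof -
  let ?N = "motion_dom n k I v" and ?J = "interval_wedge n"
  define g where "g x w q = motion n I v x w q / sqrt (sq_norm k (motion n I v x w))" for x w q
  have sub: "?N \<times> arms n \<subseteq> conf n k \<times> arms n" by (auto simp: motion_dom_def)
  have pos: "sq_norm k (motion n I v x w) > 0" if "x \<in> ?N" "w \<in> arms n" for x w
  proof -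
    have "sq_norm k (motion n I v x w) \<ge> 0" by (auto simp: sq_norm_def intro: sum_nonneg)
    with that show ?thesis by (fastforce simp: motion_dom_def)
  qed
  have mq: "continuous_on (?N \<times> arms n) (\<lambda>p. motion n I v (fst p) (snd p) q)" for q
    by (rule continuous_on_subset[OF continuous_on_motion[OF v(1) n] sub])
  have "continuous_on (?N \<times> arms n) (\<lambda>p. g (fst p) (snd p) q)" for q
    unfolding g_def sq_norm_def
    by (intro continuous_on_divide continuous_on_real_sqrt continuous_on_sum continuous_on_power mq)
      (use pos in \<open>force simp: sq_norm_def\<close>)
  then have cg: "continuous_on (?N \<times> arms n) (\<lambda>p. g (fst p) (snd p))"
    by (rule continuous_on_coordinatewise_then_product)
  have gS: "g x w \<in> Sph k" if x: "x \<in> ?N" and w: "w \<in> arms n" for x w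
  proof -
    have "(\<Sum>q\<le>k. (g x w q)\<^sup>2) = (\<Sum>q\<le>k. (motion n I v x w q)\<^sup>2) / sq_norm k (motion n I v x w)"
      using pos[OF x w] by (simp add: g_def power_divide sum_divide_distrib)
    then have "(\<Sum>q\<le>k. (g x w q)\<^sup>2) = 1" using pos[OF x w] by (simp add: sq_norm_def)
    moreover have "g x w q = 0" if q: "q > k" for q
    proof -
      have 0: "x i q = 0" if "i \<in> {1..n}" for i
        using x that q by (auto simp: motion_dom_def conf_def Sph_def PiE_def Pi_def)
      have "(\<Sum>i=2..n. w i * (x i q - x 1 q) + (if i \<in> I then 4 * w i * (1 - w i) * v (x 1) q else 0)) = 0"
        using n q by (intro sum.neutral) (auto simp: 0 v(2))
      then have "motion n I v x w q = 0" using n by (simp add: motion_def 0)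
      then show ?thesis by (simp add: g_def)
    qed
    ultimately show ?thesis by (simp add: Sph_def)
  qed
  have "continuous_map (top_of_set (?N \<times> arms n)) (top_of_set (Sph k)) (\<lambda>p. g (fst p) (snd p))"
    using cg gS by (auto simp: continuous_map_in_subtopology)
  moreover have "continuous_map (prod_topology (top_of_set ?N) ?J) (top_of_set (?N \<times> arms n))
      (\<lambda>p. (fst p, wedge_coords (snd p)))"
    unfolding prod_topology_subtopology_eu[symmetric]
    by (intro continuous_map_pairedI continuous_map_fst
        continuous_map_compose[OF continuous_map_snd continuous_map_wedge_coords, unfolded comp_def])
  ultimately have "continuous_map (prod_topology (top_of_set ?N) ?J) (top_of_set (Sph k))
      ((\<lambda>p. g (fst p) (snd p)) \<circ> (\<lambda>p. (fst p, wedge_coords (snd p))))"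
    using continuous_map_compose by blast
  then have "continuous_map (prod_topology (top_of_set ?N) ?J) (top_of_set (Sph k)) (\<lambda>(x, z). g x (wedge_coords z))"
    by (simp add: comp_def case_prod_unfold)
  from continuous_map_curry[OF this]
  have "continuous_map (top_of_set ?N) (map_space ?J (top_of_set (Sph k)))
      (\<lambda>x. restrict (\<lambda>z. g x (wedge_coords z)) (topspace ?J))" .
  moreover have "end_eval n (restrict (\<lambda>z. g x (wedge_coords z)) (topspace ?J)) = x" if x: "x \<in> ?N" for x
  proof
    fix b
    show "end_eval n (restrict (\<lambda>z. g x (wedge_coords z)) (topspace ?J)) b = x b"
    proof (cases "b \<in> {1..n}")
      case True
      then have xb: "x b \<in> Sph k" using x by (auto simp: motion_dom_def conf_def)
      have "motion n I v x (axis_point b 1) = x b"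
        using True by (auto simp: motion_arm fun_eq_iff)
      moreover have "sq_norm k (x b) = 1" using xb by (simp add: Sph_def sq_norm_def)
      ultimately have "g x (axis_point b 1) = x b" by (simp add: g_def[abs_def])
      moreover have "wedge_proj (b, 1) \<in> topspace ?J"
        using True by (auto simp: topspace_interval_wedge)
      ultimately show ?thesis using True by (simp add: end_eval_def wedge_coords_proj)
    next
      case False
      then show ?thesis using x by (auto simp: end_eval_def motion_dom_def conf_def PiE_def extensional_def)
    qed
  qed
  ultimately show ?thesis by blast
qed

text \<open>A straight segment between unit vectors meets the origin only at its midpoint, and only
  if its ends are antipodal; \<open>anti\<close> puts just these indices into \<open>I\<close>. A
  bent arm is (1 - 2t) x_1 + 4t(1 - t) v(x_1); it is plus or minus x_1 at its ends, and a zero in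
  between would make v(x_1) a multiple of x_1.\<close>

lemma motion_domI:
  assumes x: "x \<in> conf n k" and n: "n \<ge> 1" and v: "\<And>u q. q > k \<Longrightarrow> v u q = 0"
    and anti: "\<And>i. i \<in> {2..n} \<Longrightarrow> i \<in> I \<longleftrightarrow> (\<forall>q\<le>k. x i q = - x 1 q)"
    and indep: "\<And>c. v (x 1) \<noteq> (\<lambda>q. c * x 1 q)"
  shows "x \<in> motion_dom n k I v"
proof -
  have xi: "(\<Sum>q\<le>k. (x i q)\<^sup>2) = 1" "\<And>q. q > k \<Longrightarrow> x i q = 0" if "i \<in> {1..n}" for i
    using x that by (auto simp: conf_def Sph_def PiE_def Pi_def)
  have one: "1 \<in> {1..n}" using n by simp
  have nz: "\<not> (\<forall>q\<le>k. x 1 q = 0)"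
  proof
    assume "\<forall>q\<le>k. x 1 q = 0"
    then have "(\<Sum>q\<le>k. (x 1 q)\<^sup>2) = 0" by simp
    with xi(1)[OF one] show False by simp
  qed
  have False if b: "b \<in> {1..n}" and t: "t \<in> {0..1}" and z: "sq_norm k (motion n I v x (axis_point b t)) = 0" for b t
  proof -
    have m0: "motion n I v x (axis_point b t) q = 0" if "q \<le> k" for q
      using z that unfolding sq_norm_def by (subst (asm) sum_nonneg_eq_0_iff) auto
    have b1: "b \<noteq> 1"
      using m0 nz b by (auto simp: motion_arm)
    then have b2: "b \<in> {2..n}" using b by auto
    show False
    proof (cases "b \<in> I")
      case False
      have eq: "(1 - t) * x 1 q = - (t * x b q)" if "q \<le> k" for q
        using m0[OF that] b b1 False by (simp add: motion_arm algebra_simps)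
      have "(\<Sum>q\<le>k. ((1 - t) * x 1 q)\<^sup>2) = (\<Sum>q\<le>k. (t * x b q)\<^sup>2)"
        by (rule sum.cong) (simp_all only: eq atMost_iff power2_minus)
      then have "(1 - t)\<^sup>2 = t\<^sup>2"
        using xi(1)[OF one] xi(1)[OF b] by (simp add: power_mult_distrib flip: sum_distrib_left)
      then have t: "t = 1 / 2" by (simp add: power2_eq_square algebra_simps)
      have "x b q = - x 1 q" if "q \<le> k" for q
        using eq[OF that] unfolding t by simp
      then have "\<forall>q\<le>k. x b q = - x 1 q" by blast
      with anti[OF b2] False show False by blast
    next
      case True
      then have xb: "\<forall>q\<le>k. x b q = - x 1 q" using anti[OF b2] by blast
      have eq: "(1 - 2 * t) * x 1 q + 4 * t * (1 - t) * v (x 1) q = 0" if "q \<le> k" for q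
        using m0[OF that] b b1 True xb that by (simp add: motion_arm algebra_simps)
      show False
      proof (cases "t = 0 \<or> t = 1")
        case True
        then show False using eq nz by auto
      next
        case False
        then have nt: "4 * t * (1 - t) \<noteq> 0" by simp
        define c where "c = - (1 - 2 * t) / (4 * t * (1 - t))"
        have "v (x 1) q = c * x 1 q" for q
        proof (cases "q \<le> k")
          case True
          have "4 * t * (1 - t) * v (x 1) q = - (1 - 2 * t) * x 1 q"
            using eq[OF True] by (simp add: algebra_simps)
          then show ?thesis using nt by (simp add: c_def nonzero_eq_divide_eq mult.commute)
        next
          case False
          then show ?thesis using v xi(2)[OF one] by simp
        qed
        then have "v (x 1) = (\<lambda>q. c * x 1 q)" by (rule ext)
        with indep show False by blast
      qed
    qed
  qed
  then have "\<forall>w\<in>arms n. sq_norm k (motion n I v x w) \<noteq> 0"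
    unfolding arms_def by blast
  with x show ?thesis by (simp add: motion_dom_def)
qed

section \<open>The value of the higher topological complexity\<close>

text \<open>The set \<open>U I\<close> of the points at which every \<open>d i\<close> with \<open>i \<in> I\<close> is smaller than every \<open>d j\<close> with
  \<open>j \<notin> I\<close> is open, and sets \<open>U I\<close> with distinct \<open>I\<close> of equal size are disjoint, so that the sections
  over them can be glued.\<close>

lemma schwarz_genus_le_strata:
  fixes d :: "'q \<Rightarrow> 'x::topological_space \<Rightarrow> real"
  assumes Q: "finite Q" and d: "\<And>q. q \<in> Q \<Longrightarrow> continuous_on X (d q)"
    and d0: "\<And>q x. q \<in> Q \<Longrightarrow> x \<in> X \<Longrightarrow> d q x \<ge> 0"
    and N: "\<And>I. I \<subseteq> Q \<Longrightarrow> openin (top_of_set X) (N I)"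
    and s: "\<And>I. I \<subseteq> Q \<Longrightarrow> \<exists>s. continuous_map (top_of_set (N I)) T s \<and> (\<forall>x\<in>N I. p (s x) = x)"
    and x: "\<And>x. x \<in> X \<Longrightarrow> x \<in> N {q \<in> Q. d q x = 0}"
  shows "schwarz_genus T (top_of_set X) p \<le> enat (card Q + 1)"
proof -
  obtain s where s: "\<And>I. I \<subseteq> Q \<Longrightarrow> continuous_map (top_of_set (N I)) T (s I)"
      "\<And>I x. I \<subseteq> Q \<Longrightarrow> x \<in> N I \<Longrightarrow> p (s I x) = x"
    using s by metis
  define U where "U I = N I \<inter> ((\<Inter>(i, j)\<in>I \<times> (Q - I). {x \<in> X. d i x < d j x}) \<inter> topspace (top_of_set X))" for I
  have U_open: "openin (top_of_set X) (U I)" if I: "I \<subseteq> Q" for I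
    unfolding U_def
  proof (rule openin_Int[OF N[OF I] openin_INT])
    show "finite (I \<times> (Q - I))" using I Q finite_subset by auto
    fix r assume "r \<in> I \<times> (Q - I)"
    then obtain i j where r: "r = (i, j)" "i \<in> Q" "j \<in> Q" using I by auto
    have "openin (top_of_set X) (X \<inter> (\<lambda>x. d j x - d i x) -` {0<..})"
      by (rule continuous_openin_preimage_gen[OF continuous_on_diff[OF d d]]) (use r in auto)
    moreover have "X \<inter> (\<lambda>x. d j x - d i x) -` {0<..} = {x \<in> X. d i x < d j x}" by auto
    ultimately show "openin (top_of_set X) (case r of (i, j) \<Rightarrow> {x \<in> X. d i x < d j x})"
      by (simp add: r)
  qed
  have disj: "I = J" if "I \<subseteq> Q" "J \<subseteq> Q" "card I = card J" "x \<in> U I" "x \<in> U J" for I J x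
  proof (rule ccontr)
    assume "I \<noteq> J"
    have "finite I" "finite J" using that Q finite_subset by auto
    then have "\<not> I \<subseteq> J" "\<not> J \<subseteq> I"
      using \<open>I \<noteq> J\<close> that(3) card_subset_eq by metis+
    then obtain i j where ij: "i \<in> I - J" "j \<in> J - I" by blast
    then have "d i x < d j x" "d j x < d i x"
      using that unfolding U_def by (fastforce dest: INT_D[where a = "(i, j)"], fastforce dest: INT_D[where a = "(j, i)"])
    then show False by simp
  qed
  \<comment> \<open>The sizes 0, ..., \<open>card Q\<close> of \<open>I\<close> are shifted to the
    cover indices 1, ..., \<open>card Q + 1\<close>.\<close>
  define W where "W m = (\<Union>I\<in>{I. I \<subseteq> Q \<and> card I = m - 1}. U I)" for m
  have W_open: "openin (top_of_set X) (W m)" for m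
    unfolding W_def using U_open by blast
  have W_sec: "\<exists>g. continuous_map (subtopology (top_of_set X) (W m)) T g \<and> (\<forall>x\<in>W m. p (g x) = x)" for m
  proof -
    let ?I = "{I. I \<subseteq> Q \<and> card I = m - 1}"
    have WX: "W m \<subseteq> X" using openin_subset[OF W_open[of m]] by simp
    then have top: "subtopology (top_of_set X) (W m) = top_of_set (W m)"
      by (simp add: subtopology_subtopology Int_absorb1)
    have UW: "U I \<subseteq> W m" if "I \<in> ?I" for I using that by (auto simp: W_def)
    obtain g where g: "continuous_map (top_of_set (W m)) T g"
      "\<And>x I. I \<in> ?I \<Longrightarrow> x \<in> topspace (top_of_set (W m)) \<inter> U I \<Longrightarrow> g x = s I x"
    proof (rule pasting_lemma_exists[where X = "top_of_set (W m)" and Y = T and I = ?I and T = U and f = s])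
      show "topspace (top_of_set (W m)) \<subseteq> (\<Union>I\<in>?I. U I)" by (simp add: W_def)
      fix I assume I: "I \<in> ?I"
      show "openin (top_of_set (W m)) (U I)"
        using openin_subset_trans[OF U_open UW[OF I] WX] I by simp
      have "U I \<subseteq> N I" by (auto simp: U_def)
      then have "continuous_map (top_of_set (U I)) T (s I)"
        using continuous_map_from_subtopology_mono s(1) I by blast
      then show "continuous_map (subtopology (top_of_set (W m)) (U I)) T (s I)"
        using UW[OF I] by (simp add: subtopology_subtopology Int_absorb1)
      fix J x assume "J \<in> ?I" "x \<in> topspace (top_of_set (W m)) \<inter> U I \<inter> U J"
      then show "s I x = s J x" using disj[of I J x] I by auto
    qed blast
    have "p (g x) = x" if "x \<in> W m" for x
    proof -
      from \<open>x \<in> W m\<close> obtain I where I: "I \<in> ?I" "x \<in> U I"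
        unfolding W_def by (rule UN_E)
      then have "g x = s I x" using that by (intro g(2)) auto
      moreover have "x \<in> N I" using I by (simp add: U_def)
      ultimately show ?thesis using s(2) I by auto
    qed
    with g(1) show ?thesis unfolding top by blast
  qed
  have "X \<subseteq> (\<Union>m\<in>{1..card Q + 1}. W m)"
  proof
    fix y assume y: "y \<in> X"
    let ?I = "{q \<in> Q. d q y = 0}"
    have lt: "d i y < d j y" if "i \<in> ?I" "j \<in> Q - ?I" for i j
      using that d0[of j y] y by auto
    have "y \<in> (\<Inter>(i, j)\<in>?I \<times> (Q - ?I). {x \<in> X. d i x < d j x})"
    proof
      fix r assume "r \<in> ?I \<times> (Q - ?I)"
      then show "y \<in> (case r of (i, j) \<Rightarrow> {x \<in> X. d i x < d j x})"
        using lt y by (cases r) blast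
    qed
    then have "y \<in> U ?I" using x[OF y] y unfolding U_def by simp
    then have "y \<in> W (card ?I + 1)"
      unfolding W_def by (intro UN_I[of ?I]) auto
    moreover have "card ?I \<le> card Q" by (rule card_mono[OF Q]) auto
    ultimately show "y \<in> (\<Union>m\<in>{1..card Q + 1}. W m)"
      by (intro UN_I[of "card ?I + 1"]) auto
  qed
  moreover have "W m \<subseteq> X" for m using openin_subset[OF W_open[of m]] by simp
  ultimately have "(\<Union>m\<in>{1..card Q + 1}. W m) = topspace (top_of_set X)" by auto
  then show ?thesis
    unfolding schwarz_genus_def using W_open W_sec by (intro Inf_lower) blast
qed

lemma schwarz_genus_ge:
  assumes "\<And>j C. \<lbrakk>j < m; \<And>i. i \<in> {1..j} \<Longrightarrow> openin B (C i); (\<Union>i\<in>{1..j}. C i) = topspace B;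
      \<And>i. i \<in> {1..j} \<Longrightarrow> \<exists>s. continuous_map (subtopology B (C i)) E s \<and> (\<forall>b\<in>C i. p (s b) = b)\<rbrakk> \<Longrightarrow> False"
  shows "enat m \<le> schwarz_genus E B p"
  unfolding schwarz_genus_def
proof (rule Inf_greatest)
  fix e assume "e \<in> {enat k |k. \<exists>U. (\<forall>i\<in>{1..k}. openin B (U i)) \<and> (\<Union>i\<in>{1..k}. U i) = topspace B \<and>
        (\<forall>i\<in>{1..k}. \<exists>s. continuous_map (subtopology B (U i)) E s \<and> (\<forall>b\<in>U i. p (s b) = b))}"
  then obtain j U where "e = enat j" "\<forall>i\<in>{1..j}. openin B (U i)" "(\<Union>i\<in>{1..j}. U i) = topspace B"
    "\<forall>i\<in>{1..j}. \<exists>s. continuous_map (subtopology B (U i)) E s \<and> (\<forall>b\<in>U i. p (s b) = b)"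
    by blast
  with assms[of j U] show "enat m \<le> e"
    by (cases "j < m") auto
qed

lemma TC_nsphere: "TC n (nsphere k) =
  schwarz_genus (map_space (interval_wedge n) (top_of_set (Sph k))) (top_of_set (conf n k)) (end_eval n)"
  unfolding TC_def product_nsphere_eq by (simp add: nsphere_eq)

lemma TC_nsphere_ge:
  assumes nonzero: "\<And>E. E > 0 \<Longrightarrow> 4 * (real k + 1) * E\<^sup>2 < 1 \<Longrightarrow>
      \<exists>L. is_cycle E (conf n k) (m * k) L \<and> L (cup_prod k (\<lambda>i. diff_class k (a i)) m) \<noteq> 0"
    and a: "\<And>i. i < m \<Longrightarrow> a i \<in> {1..n}" and k: "k > 0"
  shows "enat (Suc m) \<le> TC n (nsphere k)"
  unfolding TC_nsphere
proof (rule schwarz_genus_ge)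
  let ?T = "map_space (interval_wedge n) (top_of_set (Sph k))"
  fix j C
  assume j: "j < Suc m" and op: "\<And>i. i \<in> {1..j} \<Longrightarrow> openin (top_of_set (conf n k)) (C i)"
    and cov: "(\<Union>i\<in>{1..j}. C i) = topspace (top_of_set (conf n k))"
    and sec: "\<And>i. i \<in> {1..j} \<Longrightarrow>
      \<exists>s. continuous_map (subtopology (top_of_set (conf n k)) (C i)) ?T s \<and> (\<forall>b\<in>C i. end_eval n (s b) = b)"
  have "\<exists>s. continuous_map (top_of_set (C i)) ?T s \<and> (\<forall>b\<in>C i. end_eval n (s b) = b)" if "i \<in> {1..j}" for i
  proof -
    have "C i \<subseteq> conf n k" using openin_subset[OF op[OF that]] by simp
    then show ?thesis using sec[OF that] by (simp add: subtopology_subtopology Int_absorb1)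
  qed
  then obtain s where s: "\<And>i. i \<in> {1..j} \<Longrightarrow> continuous_map (top_of_set (C i)) ?T (s i)"
    "\<And>i b. i \<in> {1..j} \<Longrightarrow> b \<in> C i \<Longrightarrow> end_eval n (s i b) = b"
    by metis
  \<comment> \<open>Renumbers the cover from 0 and pads it with empty sets up to exactly
    \<open>m\<close> members.\<close>
  define C' where "C' i = (if i < j then C (Suc i) else {})" for i
  have in_range: "Suc i \<in> {1..j}" if "i < j" for i using that by auto
  show False
  proof (rule no_short_cover[OF nonzero a k, where C = C' and s = "\<lambda>i. s (Suc i)"])
    show "openin (top_of_set (conf n k)) (C' i)" for i
      using op[OF in_range] by (simp add: C'_def)
    show "conf n k \<subseteq> (\<Union>i<m. C' i)"
    proof
      fix x assume "x \<in> conf n k"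
      then have "x \<in> (\<Union>i\<in>{1..j}. C i)" unfolding cov by simp
      then obtain i where "i \<in> {1..j}" "x \<in> C i" by (rule UN_E)
      then have "x \<in> C' (i - 1)" "i - 1 < m" using j by (auto simp: C'_def)
      then show "x \<in> (\<Union>i<m. C' i)" by blast
    qed
    show "continuous_map (top_of_set (C' i)) ?T (s (Suc i))" for i
      using s(1)[OF in_range] by (cases "i < j") (auto simp: C'_def continuous_map_def)
    show "end_eval n (s (Suc i) x) = x" if "x \<in> C' i" for i x
      using that s(2)[OF in_range] by (auto simp: C'_def split: if_splits)
  qed
qed

section \<open>Upper bounds for spheres\<close>

definition anti_dist :: "nat \<Rightarrow> nat \<Rightarrow> (nat \<Rightarrow> nat \<Rightarrow> real) \<Rightarrow> real" where
  "anti_dist k i x = (\<Sum>q\<le>k. (x i q + x 1 q)\<^sup>2)"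

lemma anti_dist_eq_0: "anti_dist k i x = 0 \<longleftrightarrow> (\<forall>q\<le>k. x i q = - x 1 q)"
  unfolding anti_dist_def by (subst sum_nonneg_eq_0_iff) (auto simp: add_eq_0_iff2)

lemma anti_dist_nonneg: "anti_dist k i x \<ge> 0"
  unfolding anti_dist_def by (intro sum_nonneg) auto

lemma continuous_on_coord2: "continuous_on S (\<lambda>x :: nat \<Rightarrow> nat \<Rightarrow> real. x i q)"
  by (rule continuous_on_product_then_coordinatewise[OF continuous_on_product_then_coordinatewise[OF continuous_on_id]])

lemma continuous_on_anti_dist: "continuous_on S (anti_dist k i)"
  unfolding anti_dist_def[abs_def]
  by (rule continuous_on_sum[OF continuous_on_power[OF continuous_on_add[OF continuous_on_coord2 continuous_on_coord2]]])

text \<open>For odd k, multiplication by the imaginary unit when the coordinates 2l and 2l + 1 are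
  read as one complex number: a tangent field on S^k without zeros.\<close>

definition pair_rotation :: "nat \<Rightarrow> (nat \<Rightarrow> real) \<Rightarrow> nat \<Rightarrow> real" where
  "pair_rotation k u q = (if q \<le> k then if even q then - u (Suc q) else u (q - 1) else 0)"

text \<open>A real eigenvalue c of this rotation would satisfy c^2 = -1, whence the factor 1 + c * c
  in the computation.\<close>

lemma pair_rotation_indep:
  assumes u: "u \<in> Sph k" and k: "odd k"
  shows "pair_rotation k u \<noteq> (\<lambda>q. c * u q)"
proof
  assume "pair_rotation k u = (\<lambda>q. c * u q)"
  then have eq: "pair_rotation k u q = c * u q" for q by (rule fun_cong)
  have ev: "u q = 0 \<and> u (Suc q) = 0" if q: "even q" "q \<le> k" for q
  proof -
    have "q < k" using q k by (metis le_neq_implies_less)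
    then have 1: "- u (Suc q) = c * u q" "u q = c * u (Suc q)"
      using eq[of q] eq[of "Suc q"] q by (simp_all add: pair_rotation_def)
    have a: "u (Suc q) = - (c * u q)" using 1(1) by linarith
    have "(1 + c * c) * u q = u q - c * - (c * u q)" by (simp add: algebra_simps)
    also have "\<dots> = 0" using 1(2) unfolding a by linarith
    finally have "(1 + c * c) * u q = 0" .
    moreover have "1 + c * c > 0" by (simp add: add_pos_nonneg)
    ultimately have "u q = 0" by simp
    with a show ?thesis by simp
  qed
  have "u q = 0" if "q \<le> k" for q
  proof (cases "even q")
    case False
    then have "even (q - 1)" "Suc (q - 1) = q" by auto
    then show ?thesis using ev[of "q - 1"] that by auto
  qed (use ev that in auto)
  then show False using u by (simp add: Sph_def)
qed

lemma continuous_on_pair_rotation: "continuous_on S (\<lambda>u. pair_rotation k u q)"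
proof -
  have c: "continuous_on S (\<lambda>u :: nat \<Rightarrow> real. u i)" for i
    by (rule continuous_on_product_then_coordinatewise[OF continuous_on_id])
  consider "q \<le> k" "even q" | "q \<le> k" "odd q" | "q > k" by linarith
  then show ?thesis
    by cases (auto simp: pair_rotation_def c continuous_on_minus[OF c])
qed

lemma TC_nsphere_le_odd:
  assumes n: "n \<ge> 1" and k: "odd k"
  shows "TC n (nsphere k) \<le> enat n"
proof -
  let ?N = "\<lambda>I. motion_dom n k I (pair_rotation k)"
  have v: "continuous_on (Sph k) (\<lambda>u. pair_rotation k u q)" "q > k \<Longrightarrow> pair_rotation k u q = 0" for u q
    by (auto simp: continuous_on_pair_rotation) (simp add: pair_rotation_def)
  have "TC n (nsphere k) \<le> enat (card {2..n} + 1)"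
    unfolding TC_nsphere
  proof (rule schwarz_genus_le_strata[where d = "anti_dist k" and N = ?N])
    fix x assume x: "x \<in> conf n k"
    then have x1: "x 1 \<in> Sph k" using n by (auto simp: conf_def)
    show "x \<in> ?N {q \<in> {2..n}. anti_dist k q x = 0}"
      by (rule motion_domI[OF x n v(2)]) (use pair_rotation_indep[OF x1 k] in \<open>auto simp: anti_dist_eq_0\<close>)
  qed (auto simp: continuous_on_anti_dist anti_dist_nonneg intro: openin_motion_dom motion_section v n)
  also have "card {2..n} + 1 = n" using n by simp
  finally show ?thesis .
qed

lemma TC_nsphere_le:
  assumes n: "n \<ge> 1" and k: "k \<ge> 1"
  shows "TC n (nsphere k) \<le> enat (n + 1)"
proof -
  \<comment> \<open>The index 0 does not occur in \<open>{2..n}\<close> and labels the additional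
    degeneracy: on configurations \<open>d 0\<close> vanishes exactly where \<open>x 1\<close> is
    e_0 or -e_0.\<close>
  define d where "d i x = (if i = 0 then \<Sum>q=1..k. (x 1 q)\<^sup>2 else anti_dist k i x)"
    for i :: nat and x :: "nat \<Rightarrow> nat \<Rightarrow> real"
  define v where "v I = (\<lambda>u :: nat \<Rightarrow> real. axis_point (if 0 \<in> I then 1 else 0) 1)" for I :: "nat set"
  let ?N = "\<lambda>I. motion_dom n k I (v I)"
  let ?Q = "insert 0 {2..n}"
  have v: "continuous_on (Sph k) (\<lambda>u. v I u q)" "q > k \<Longrightarrow> v I u q = 0" for I u q
    using k by (auto simp: v_def axis_point_def)
  have "continuous_on S (\<lambda>x :: nat \<Rightarrow> nat \<Rightarrow> real. \<Sum>q=1..k. (x 1 q)\<^sup>2)" for S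
    by (rule continuous_on_sum[OF continuous_on_power[OF continuous_on_coord2]])
  then have cd: "continuous_on S (d q)" for S q
    unfolding d_def[abs_def] by (cases "q = 0") (auto simp: continuous_on_anti_dist)
  have d0: "d q x \<ge> 0" for q x
    by (auto simp: d_def anti_dist_nonneg intro: sum_nonneg)
  have "TC n (nsphere k) \<le> enat (card ?Q + 1)"
    unfolding TC_nsphere
  proof (rule schwarz_genus_le_strata[where d = d and N = ?N])
    fix x assume x: "x \<in> conf n k"
    let ?I = "{q \<in> ?Q. d q x = 0}"
    show "x \<in> ?N ?I"
    proof (rule motion_domI[OF x n v(2)])
      fix i assume "i \<in> {2..n}"
      then show "i \<in> ?I \<longleftrightarrow> (\<forall>q\<le>k. x i q = - x 1 q)"
        by (auto simp: d_def anti_dist_eq_0)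
    next
      fix c
      have d_iff: "d 0 x = 0 \<longleftrightarrow> (\<forall>q\<in>{1..k}. x 1 q = 0)"
        unfolding d_def by (simp add: sum_nonneg_eq_0_iff)
      show "v ?I (x 1) \<noteq> (\<lambda>q. c * x 1 q)"
      proof
        assume "v ?I (x 1) = (\<lambda>q. c * x 1 q)"
        then have eq: "v ?I (x 1) q = c * x 1 q" for q by (rule fun_cong)
        show False
        proof (cases "d 0 x = 0")
          case True
          then have "x 1 1 = 0" using d_iff k by auto
          with eq[of 1] True show False by (simp add: v_def axis_point_def)
        next
          case False
          then have e: "axis_point 0 1 q = c * x 1 q" for q using eq[of q] by (simp add: v_def)
          have "c \<noteq> 0" using e[of 0] by (auto simp: axis_point_def)
          have "x 1 q = 0" if "q \<in> {1..k}" for q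
            using e[of q] that \<open>c \<noteq> 0\<close> by (auto simp: axis_point_def)
          with d_iff False show False by blast
        qed
      qed
    qed
  qed (auto simp: cd d0 intro: openin_motion_dom motion_section v n)
  also have "card ?Q + 1 = n + 1" using n by simp
  finally show ?thesis .
qed

theorem mainTheorem2:
  fixes n k :: nat
  assumes "n > 2" and "k > 0"
  shows "(odd k \<longrightarrow> TC n (nsphere k) = enat n) \<and>
         (even k \<longrightarrow> TC n (nsphere k) = enat (n + 1))"
proof (intro conjI impI antisym)
  assume "odd k"
  then show "TC n (nsphere k) \<le> enat n" using TC_nsphere_le_odd assms by simp
  \<comment> \<open>The indices \<open>i + 2\<close> for i < n - 1 run through 2, ..., n.\<close>
  have "enat (Suc (n - 1)) \<le> TC n (nsphere k)"
    by (rule TC_nsphere_ge[where a = "\<lambda>i. i + 2"]) (use nonzero_product[of k _ "n - 1" n] assms in auto)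
  then show "enat n \<le> TC n (nsphere k)" using assms by simp
next
  assume "even k"
  then have "enat (Suc n) \<le> TC n (nsphere k)"
    using assms by (intro TC_nsphere_ge[where a = doubled_index] nonzero_product_even) (auto simp: doubled_index_def)
  then show "enat (n + 1) \<le> TC n (nsphere k)" by simp
  show "TC n (nsphere k) \<le> enat (n + 1)" using TC_nsphere_le assms by simp
qed

end
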